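(* Let $1\le k\le n$ be integers. The equivalence classes of labeled rooted forests contained in $\mathrm{RF}_{n+1,k}$ are obtained from those contained in $\mathrm{RF}_{n,k}$ by adding a single edge and leaf to $v_f$ for each $f\in\mathrm{RF}_{n,k}$. That is, for $f\in\mathrm{RF}_n$ let $f^{+}\in\mathrm{RF}_{n+1}$ be the forest obtained from $f$ by attaching to the vertex $v_f$ a new child labeled $n+1$; then the set of equivalence classes (under $\sim$) contained in $\mathrm{RF}_{n+1,k}$ is exactly the set of equivalence classes of the forests $f^{+}$ with $f\in\mathrm{RF}_{n,k}$.
   Context: Parking functions. A parking function of length $n$ is an $n$-tuple $(a_1,\dots,a_n)$ of positive integers whose weakly increasing rearrangement $b_1\le\dots\le b_n$ satisfies $b_i\le i$ for all $i$; $\mathrm{PF}_n$ is the set of these. For $1<k\le n$, $\mathrm{PF}_{n,k}$ is the set of $a\in\mathrm{PF}_n$ such that $k$ is not an entry of $a$ but each of $k+1,\dots,n$ is an entry of $a$. The remaining elements of $\mathrm{PF}_n$ are the permutations of $(1,\dots,n)$. Forests. A rooted forest is a collection of trees, each with one vertex designated as its root. $\mathrm{RF}_n$ is the set of rooted forests on $n$ vertices whose vertices are labeled bijectively by $\{1,\dots,n\}$. For a vertex $v$, $h(v)$ is the distance from $v$ to the root of its tree; if $v,w$ are adjacent and $h(w)=h(v)+1$, then $v$ is the parent of $w$ and $w$ is a child of $v$. Two distinct vertices are siblings if they have the same parent or are both roots. $\eta(v)=i$ if $v$ has the $i$-th smallest label among the set consisting of $v$ and its siblings. $P_f$ is the unique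 path in $f$ from a root to a leaf (a vertex with no children) all of whose vertices $v$ satisfy $\eta(v)=1$, and $v_f$ is the leaf at its end. Two forests $f_1,f_2\in\mathrm{RF}_n$ are equivalent, $f_1\sim f_2$, if there is a graph isomorphism $\psi:f_1\to f_2$ with $h(\psi(v))=h(v)$ and $\eta(\psi(v))=\eta(v)$ for all vertices $v$ of $f_1$. Bijection $\phi:\mathrm{RF}_n\to\mathrm{PF}_n$. Given $f\in\mathrm{RF}_n$, form a labeled binary rooted tree $b$ with the same labeled vertices: the root of $b$ is the root of $f$ with $\eta=1$; the left child in $b$ of a vertex $v$ is the sibling $w$ of $v$ in $f$ with $\eta(w)=\eta(v)+1$, if it exists; the right child in $b$ of $v$ is the child $x$ of $v$ in $f$ with $\eta(x)=1$, if it exists. Walk counterclockwise around the outside of $b$ starting at its root: at the first encounter with a vertex record an up step labeled by that vertex; if the vertex has a left child, record a right step when the vertex is encountered for the second time (after going around its left subtree); otherwise record the right step immediately after the up step. (Recursively, the word of a subtree with root $v$, left subtree $L$ and right subtree $R$ is $U_v\,D(L)\,\mathrm{(right)}\,D(R)$, where $D$ of the empty tree is empty.) This gives a labeled Dyck path, and $\phi(f)=(a_1,\dots,a_n)$ where $a_i$ is $1$ plus the number of right steps preceding the up step labeled $i$. The map $\phi$ is a bijection. For $1<k\le n$, $\mathrm{RF}_{n,k}=\phi^{-1}(\mathrm{PF}_{n,k})$, and $\mathrm{RF}_{n,1}$ is the set of $f\in\mathrm{RF}_n$ such that $\phi(f)$ is a permutation of $(1,\dots,n)$. Each $\mathrm{RF}_{n,k}$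 is a union of equivalence classes. *)

theory Defs
  imports "HOL-Library.Tree" "HOL-Library.Multiset"
begin

section \<open>Parking functions\<close>

text \<open>An \<open>n\<close>-tuple \<open>(a\<^sub>1, \<dots>, a\<^sub>n)\<close> is a list of length \<open>n\<close>; the entry \<open>a\<^sub>i\<close> is \<open>a ! (i - 1)\<close>.\<close>

definition PF :: "nat \<Rightarrow> nat list set" where
  "PF n = {a. length a = n \<and> (\<forall>x \<in> set a. 1 \<le> x) \<and> (\<forall>i < n. sort a ! i \<le> i + 1)}"

definition PF_missing :: "nat \<Rightarrow> nat \<Rightarrow> nat list set" where
  "PF_missing n k = {a \<in> PF n. k \<notin> set a \<and> {k+1..n} \<subseteq> set a}"


section \<open>Rooted forests\<close>

text \<open>Undirected simple graphs, with edges as two-element sets of vertices. (In the directed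
  graphs of \<open>Graph_Theory\<close>, a symmetric pair of arcs already counts as a cycle, so the
  notion of a forest there is not the undirected one.)\<close>

record rforest =
  verts :: "nat set"
  edges :: "nat set set"
  roots :: "nat set"

definition adj :: "rforest \<Rightarrow> nat \<Rightarrow> nat \<Rightarrow> bool" where
  "adj f u v \<longleftrightarrow> {u, v} \<in> edges f"

definition walk :: "rforest \<Rightarrow> nat \<Rightarrow> nat list \<Rightarrow> nat \<Rightarrow> bool" where
  "walk f u p v \<longleftrightarrow>
     p \<noteq> [] \<and> hd p = u \<and> last p = v \<and> set p \<subseteq> verts f \<and> successively (adj f) p"

definition path :: "rforest \<Rightarrow> nat \<Rightarrow> nat list \<Rightarrow> nat \<Rightarrow> bool" where
  "path f u p v \<longleftrightarrow> walk f u p v \<and> distinct p"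

definition same_component :: "rforest \<Rightarrow> nat \<Rightarrow> nat \<Rightarrow> bool" where
  "same_component f u v \<longleftrightarrow> (\<exists>p. walk f u p v)"

definition acyclic_graph :: "rforest \<Rightarrow> bool" where
  "acyclic_graph f \<longleftrightarrow> \<not> (\<exists>p u v. path f u p v \<and> 3 \<le> length p \<and> adj f v u)"

definition RF :: "nat \<Rightarrow> rforest set" where
  "RF n = {f. verts f = {1..n}
            \<and> (\<forall>e \<in> edges f. e \<subseteq> verts f \<and> card e = 2)
            \<and> acyclic_graph f
            \<and> roots f \<subseteq> verts f
            \<and> (\<forall>v \<in> verts f. \<exists>!r. r \<in> roots f \<and> same_component f r v)}"

definition graph_dist :: "rforest \<Rightarrow> nat \<Rightarrow> nat \<Rightarrow> nat" where
  "graph_dist f u v = (LEAST d. \<exists>p. walk f u p v \<and> length p = d + 1)"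

definition root_of :: "rforest \<Rightarrow> nat \<Rightarrow> nat" where
  "root_of f v = (THE r. r \<in> roots f \<and> same_component f r v)"

definition ht :: "rforest \<Rightarrow> nat \<Rightarrow> nat" where
  "ht f v = graph_dist f v (root_of f v)"

definition parent :: "rforest \<Rightarrow> nat \<Rightarrow> nat \<Rightarrow> bool" where
  "parent f v w \<longleftrightarrow> adj f v w \<and> ht f w = ht f v + 1"

definition siblings :: "rforest \<Rightarrow> nat \<Rightarrow> nat \<Rightarrow> bool" where
  "siblings f v w \<longleftrightarrow>
     v \<noteq> w \<and> ((\<exists>u. parent f u v \<and> parent f u w) \<or> (v \<in> roots f \<and> w \<in> roots f))"

definition eta :: "rforest \<Rightarrow> nat \<Rightarrow> nat" where
  "eta f v = card {w \<in> insert v {w. siblings f v w}. w \<le> v}"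

definition leaf :: "rforest \<Rightarrow> nat \<Rightarrow> bool" where
  "leaf f v \<longleftrightarrow> v \<in> verts f \<and> \<not> (\<exists>w. parent f v w)"

definition first_path :: "rforest \<Rightarrow> nat list" where
  "first_path f = (THE p. \<exists>r v. r \<in> roots f \<and> leaf f v \<and> path f r p v \<and> (\<forall>u \<in> set p. eta f u = 1))"

definition first_leaf :: "rforest \<Rightarrow> nat" where
  "first_leaf f = last (first_path f)"

definition forest_equiv :: "rforest \<Rightarrow> rforest \<Rightarrow> bool" (infix "\<sim>\<^sub>F" 50) where
  "f \<sim>\<^sub>F g \<longleftrightarrow> (\<exists>\<psi>. bij_betw \<psi> (verts f) (verts g)
     \<and> (\<forall>u \<in> verts f. \<forall>v \<in> verts f. adj f u v \<longleftrightarrow> adj g (\<psi> u) (\<psi> v))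
     \<and> (\<forall>v \<in> verts f. ht g (\<psi> v) = ht f v \<and> eta g (\<psi> v) = eta f v))"

definition RF_rel :: "nat \<Rightarrow> (rforest \<times> rforest) set" where
  "RF_rel n = {(f, g). f \<in> RF n \<and> g \<in> RF n \<and> f \<sim>\<^sub>F g}"


section \<open>The bijection from rooted forests to parking functions\<close>

definition first_root :: "rforest \<Rightarrow> nat option" where
  "first_root f =
     (if \<exists>r \<in> roots f. eta f r = 1 then Some (THE r. r \<in> roots f \<and> eta f r = 1) else None)"

definition next_sibling :: "rforest \<Rightarrow> nat \<Rightarrow> nat option" where
  "next_sibling f v =
     (if \<exists>w. siblings f v w \<and> eta f w = eta f v + 1
      then Some (THE w. siblings f v w \<and> eta f w = eta f v + 1) else None)"

definition first_child :: "rforest \<Rightarrow> nat \<Rightarrow> nat option" where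
  "first_child f v =
     (if \<exists>x. parent f v x \<and> eta f x = 1
      then Some (THE x. parent f v x \<and> eta f x = 1) else None)"

text \<open>\<open>binary_subtree f r t\<close>: \<open>t\<close> is the subtree, rooted at the optional vertex \<open>r\<close>, of the binary
  tree of \<open>f\<close>. In this section, \<open>\<langle>\<rangle>\<close> is the empty tree, not a leaf of a forest.\<close>

inductive binary_subtree :: "rforest \<Rightarrow> nat option \<Rightarrow> nat tree \<Rightarrow> bool" for f where
  empty: "binary_subtree f None \<langle>\<rangle>"
| node: "binary_subtree f (next_sibling f v) l \<Longrightarrow> binary_subtree f (first_child f v) r
         \<Longrightarrow> binary_subtree f (Some v) \<langle>l, v, r\<rangle>"

definition binary_tree :: "rforest \<Rightarrow> nat tree" where
  "binary_tree f = (THE b. binary_subtree f (first_root f) b)"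

datatype step = Up nat | Rightwards

primrec dyck_word :: "nat tree \<Rightarrow> step list" where
  "dyck_word \<langle>\<rangle> = []"
| "dyck_word \<langle>l, v, r\<rangle> = Up v # dyck_word l @ [Rightwards] @ dyck_word r"

definition phi :: "rforest \<Rightarrow> nat list" where
  "phi f = map (\<lambda>i. 1 + count_list (takeWhile (\<lambda>s. s \<noteq> Up i) (dyck_word (binary_tree f))) Rightwards)
             [1..<card (verts f) + 1]"

definition RF_k :: "nat \<Rightarrow> nat \<Rightarrow> rforest set" where
  "RF_k n k = (if k = 1 then {f \<in> RF n. mset (phi f) = mset [1..<n+1]}
               else {f \<in> RF n. phi f \<in> PF_missing n k})"


section \<open>Attaching a leaf\<close>

text \<open>For \<open>f \<in> RF n\<close> the new label \<open>card (verts f) + 1\<close> is \<open>n + 1\<close>.\<close>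

definition forest_plus :: "rforest \<Rightarrow> rforest" where
  "forest_plus f = (let m = card (verts f) + 1 in
     \<lparr>verts = insert m (verts f), edges = insert {first_leaf f, m} (edges f), roots = roots f\<rparr>)"

end

theory Submission
  imports Defs
begin

text \<open>The right spine of the binary tree of a forest \<open>f\<close> is the path \<open>P\<^sub>f\<close>, and along this spine the
  Dyck word splits into its prime factors. Attaching the leaf \<open>n + 1\<close> to \<open>v\<^sub>f\<close> lengthens the spine by
  one vertex, so it appends \<open>Up (n + 1), Rightwards\<close> to the word and the entry \<open>n + 1\<close> to \<open>phi f\<close>;
  membership in \<open>RF_k\<close> is unaffected. Conversely, let \<open>k \<le> n\<close> and \<open>g \<in> RF_k (n + 1) k\<close>. Then \<open>n + 1\<close> is
  an entry of \<open>phi g\<close>, so some up step is preceded by \<open>n\<close> of the \<open>n + 1\<close> right steps. Its vertex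
  can only be the end \<open>v\<^sub>g\<close> of the spine, and it has no siblings. Hence \<open>v\<^sub>g\<close> can be
  relabelled \<open>n + 1\<close>, keeping the order of the other labels, without leaving the equivalence class,
  and then deleted.\<close>

section \<open>Walks\<close>

text \<open>The end of the spine is found by counting. The right step of a vertex comes after its up
  step and after its whole left subtree. If \<open>n\<close> of the \<open>n + 1\<close> right steps
  precede \<open>Up i\<close>, only the right step of \<open>i\<close> itself can follow. So
  \<open>i\<close> has empty subtrees in the binary tree and lies in the left subtree of no vertex:
  it ends the spine. An empty left subtree means no next sibling, and \<open>eta\<close> is
  \<open>1\<close> along the spine, so \<open>i\<close> has no siblings at all.

  This is used twice. Equivalence sees labels only through their order among siblings, so a vertex
  without siblings may move anywhere in that order; and deleting an only child turns its parent into
  a leaf, so the shortened spine is again the first path.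

  The obstacle is that \<open>RF\<close>, \<open>ht\<close> and \<open>first_path\<close> rest on
  walks, shortest distances and unique choice, which are hard to follow through a change of the
  graph. Heights are therefore treated as functions that change by one along edges, vanish exactly
  at the roots and give every other vertex one lower neighbour. Such a function certifies membership
  in \<open>RF\<close> and must equal \<open>ht\<close>.\<close>

lemma adj_sym: "adj f u v \<longleftrightarrow> adj f v u"
  by (simp add: adj_def insert_commute)

lemma walk_refl: "v \<in> verts f \<Longrightarrow> walk f v [v] v"
  by (simp add: walk_def)

lemma walk_Cons: "walk f v p w \<Longrightarrow> adj f u v \<Longrightarrow> u \<in> verts f \<Longrightarrow> walk f u (u # p) w"
  by (cases p) (auto simp: walk_def)

text \<open>\<open>tl q\<close> drops the junction \<open>v\<close>, which already ends
  \<open>p\<close>.\<close>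

lemma walk_append:
  assumes "walk f u p v" "walk f v q w"
  shows "walk f u (p @ tl q) w"
proof (cases q)
  case Nil
  then show ?thesis using assms by (simp add: walk_def)
next
  case (Cons a q')
  then show ?thesis
    using assms by (cases q') (auto simp: walk_def successively_append_iff)
qed

lemma walk_rev: "walk f u p v \<Longrightarrow> walk f v (rev p) u"
  by (auto simp: walk_def hd_rev last_rev adj_sym[of f])

lemma same_component_refl: "v \<in> verts f \<Longrightarrow> same_component f v v"
  using walk_refl by (auto simp: same_component_def)

lemma same_component_sym: "same_component f u v \<Longrightarrow> same_component f v u"
  using walk_rev by (metis same_component_def)

lemma same_component_trans:
  "same_component f u v \<Longrightarrow> same_component f v w \<Longrightarrow> same_component f u w"
  using walk_append by (fastforce simp: same_component_def)

text \<open>The segment between two occurrences of a repeated vertex is cut out until none is left.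
  Recording \<open>set q \<subseteq> set p\<close> lets bounds on heights pass from the walk to the
  path.\<close>

lemma walk_imp_path: "walk f u p v \<Longrightarrow> \<exists>q. path f u q v \<and> set q \<subseteq> set p"
proof (induction "length p" arbitrary: p rule: less_induct)
  case less
  show ?case
  proof (cases "distinct p")
    case True
    then show ?thesis using less.prems by (auto simp: path_def)
  next
    case False
    then obtain xs ys zs y where p: "p = xs @ [y] @ ys @ [y] @ zs"
      using not_distinct_decomp by blast
    let ?p = "xs @ [y] @ zs"
    have "walk f u ?p v"
      using less.prems unfolding p walk_def
      by (auto simp: successively_append_iff successively_Cons hd_append split: if_splits)
    moreover have "length ?p < length p" by (simp add: p)
    ultimately obtain q where "path f u q v" "set q \<subseteq> set ?p"
      using less.hyps by blast
    then show ?thesis by (auto simp: p)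
  qed
qed

lemma cycle_two_neighbours:
  assumes "path f u p v" "3 \<le> length p" "adj f v u" "x \<in> set p"
  obtains y z where "y \<noteq> z" "adj f x y" "adj f x z" "y \<in> set p" "z \<in> set p"
proof -
  let ?n = "length p"
  have p: "distinct p" "p \<noteq> []" "hd p = u" "last p = v" "successively (adj f) p"
    using assms by (auto simp: path_def walk_def)
  have step: "adj f (p ! i) (p ! Suc i)" if "Suc i < ?n" for i
    using p(5) that by (simp add: successively_conv_nth)
  have wrap: "adj f (p ! (?n - 1)) (p ! 0)"
    using p assms(3) by (simp add: hd_conv_nth last_conv_nth)
  obtain i where i: "i < ?n" "x = p ! i" using assms(4) by (auto simp: in_set_conv_nth)
  \<comment> \<open>Cyclic successor and predecessor of position \<open>i\<close>; they differ
    because the cycle has at least three vertices.\<close>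
  define j where "j = (if Suc i < ?n then Suc i else 0)"
  define k where "k = (if i = 0 then ?n - 1 else i - 1)"
  have "j < ?n" "k < ?n" "j \<noteq> k" using i assms(2) by (auto simp: j_def k_def)
  moreover have "adj f x (p ! j)"
  proof (cases "Suc i < ?n")
    case False
    then have "i = ?n - 1" using i by simp
    then show ?thesis using wrap i False by (simp add: j_def)
  qed (use step i in \<open>simp add: j_def\<close>)
  moreover have "adj f x (p ! k)"
  proof (cases "i = 0")
    case True
    then show ?thesis using wrap i adj_sym by (simp add: k_def)
  next
    case False
    then show ?thesis using step[of "i - 1"] i adj_sym by (simp add: k_def)
  qed
  ultimately show thesis using that[of "p ! j" "p ! k"] p(1) by (simp add: nth_eq_iff_index_eq)
qed

section \<open>Forests as graphs with a height function\<close>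

text \<open>Every later construction of a forest is checked against this walk-free characterisation.\<close>

definition is_height :: "rforest \<Rightarrow> (nat \<Rightarrow> nat) \<Rightarrow> bool" where
  "is_height f h \<longleftrightarrow>
     (\<forall>e \<in> edges f. e \<subseteq> verts f \<and> card e = 2) \<and> roots f \<subseteq> verts f \<and>
     (\<forall>v \<in> verts f. h v = 0 \<longleftrightarrow> v \<in> roots f) \<and>
     (\<forall>u v. adj f u v \<longrightarrow> h u = Suc (h v) \<or> h v = Suc (h u)) \<and>
     (\<forall>v \<in> verts f - roots f. \<exists>!u. adj f u v \<and> h v = Suc (h u))"

section \<open>From forests to height functions\<close>

context
  fixes f :: rforest and n :: nat
  assumes RF: "f \<in> RF n"
begin

lemma RF_edge: "e \<in> edges f \<Longrightarrow> e \<subseteq> verts f \<and> card e = 2"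
  using RF by (auto simp: RF_def)

lemma RF_adj: "adj f u v \<Longrightarrow> u \<in> verts f \<and> v \<in> verts f \<and> u \<noteq> v"
  using RF_edge[of "{u, v}"] by (auto simp: adj_def)

lemma RF_roots: "r \<in> roots f \<Longrightarrow> r \<in> verts f"
  using RF by (auto simp: RF_def)

lemma root_of: "v \<in> verts f \<Longrightarrow> root_of f v \<in> roots f \<and> same_component f (root_of f v) v"
proof -
  assume "v \<in> verts f"
  then have "\<exists>!r. r \<in> roots f \<and> same_component f r v" using RF unfolding RF_def by blast
  then show ?thesis unfolding root_of_def by (rule theI')
qed

lemma root_of_eq:
  "v \<in> verts f \<Longrightarrow> r \<in> roots f \<Longrightarrow> same_component f r v \<Longrightarrow> root_of f v = r"
  using root_of[of v] RF unfolding RF_def by blast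

lemma same_component_adj: "adj f u v \<Longrightarrow> same_component f u v"
  using RF_adj walk_Cons[OF walk_refl] unfolding same_component_def by blast

lemma root_of_adj: "adj f u v \<Longrightarrow> root_of f u = root_of f v"
proof -
  assume "adj f u v"
  moreover from this have "u \<in> verts f" "v \<in> verts f" using RF_adj by blast+
  ultimately show ?thesis
    using root_of[of v] same_component_adj adj_sym
    by (intro root_of_eq) (blast intro: same_component_trans)+
qed

lemma root_of_root: "r \<in> roots f \<Longrightarrow> root_of f r = r"
  using root_of_eq RF_roots same_component_refl by blast

lemma ht_walk: "v \<in> verts f \<Longrightarrow> \<exists>p. walk f v p (root_of f v) \<and> length p = ht f v + 1"
proof -
  assume "v \<in> verts f"
  then obtain p where p: "walk f v p (root_of f v)"
    using root_of same_component_sym by (metis same_component_def)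
  then have "length p = (length p - 1) + 1" by (cases p) (auto simp: walk_def)
  then have "\<exists>d p. walk f v p (root_of f v) \<and> length p = d + 1" using p by blast
  then show ?thesis unfolding ht_def graph_dist_def by (rule LeastI_ex)
qed

lemma ht_le: "walk f v p (root_of f v) \<Longrightarrow> ht f v + 1 \<le> length p"
proof -
  assume p: "walk f v p (root_of f v)"
  then have "length p = (length p - 1) + 1" by (cases p) (auto simp: walk_def)
  then have "ht f v \<le> length p - 1" unfolding ht_def graph_dist_def
    using p by (intro Least_le) blast
  then show ?thesis using p by (cases p) (auto simp: walk_def)
qed

lemma ht_adj_le: "adj f u v \<Longrightarrow> ht f u \<le> Suc (ht f v)"
  using ht_walk[of v] ht_le[of u] walk_Cons root_of_adj RF_adj by fastforce

lemma ht_eq_0_iff: "v \<in> verts f \<Longrightarrow> ht f v = 0 \<longleftrightarrow> v \<in> roots f"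
proof
  assume v: "v \<in> verts f" "ht f v = 0"
  then obtain p where p: "walk f v p (root_of f v)" "length p = 1" using ht_walk by fastforce
  then have "v = root_of f v" by (cases p) (auto simp: walk_def)
  then show "v \<in> roots f" using root_of v by metis
next
  assume "v \<in> verts f" "v \<in> roots f"
  then show "ht f v = 0" using ht_le[of v "[v]"] walk_refl root_of_root by simp
qed

text \<open>The second vertex of a shortest walk to the root has height at most \<open>k\<close>,
  and \<open>ht_adj_le\<close> excludes anything smaller.\<close>

lemma ex_lower:
  assumes "v \<in> verts f" "ht f v = Suc k"
  shows "\<exists>u. adj f u v \<and> ht f u = k"
proof -
  obtain p where p: "walk f v p (root_of f v)" "length p = Suc (Suc k)"
    using ht_walk assms by fastforce
  then obtain u q where q: "p = v # u # q"
    by (cases p; cases "tl p") (auto simp: walk_def)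
  then have a: "adj f v u" "walk f u (u # q) (root_of f v)" using p by (auto simp: walk_def)
  then have "ht f u \<le> k" using ht_le root_of_adj q p by fastforce
  then show ?thesis using a ht_adj_le adj_sym assms by (metis Suc_le_mono le_antisym)
qed

lemma climb:
  "v \<in> verts f \<Longrightarrow> \<exists>p. walk f v p (root_of f v) \<and> (\<forall>x \<in> set p. ht f x \<le> ht f v)"
proof (induction "ht f v" arbitrary: v)
  case 0
  then have "root_of f v = v" using ht_eq_0_iff root_of_root by simp
  then show ?case using walk_refl[OF 0(2)] by fastforce
next
  case (Suc k)
  obtain u where u: "adj f u v" "ht f u = k" using ex_lower Suc by metis
  then obtain p where "walk f u p (root_of f u)" "\<forall>x \<in> set p. ht f x \<le> ht f u"
    using Suc RF_adj by blast
  then show ?case using walk_Cons[of f u p _ v] u adj_sym root_of_adj Suc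
    by (intro exI[of _ "v # p"]) force
qed

text \<open>Both vertices climb to their common root without rising. Since the path stays at or
  below level \<open>k\<close>, higher vertices can be added to it without repetition; this is how
  the cycles in \<open>ht_adj_neq\<close> and \<open>lower_unique\<close> arise.\<close>

lemma low_path:
  assumes "u \<in> verts f" "v \<in> verts f" "root_of f u = root_of f v" "ht f u \<le> k" "ht f v \<le> k"
  shows "\<exists>p. path f u p v \<and> (\<forall>x \<in> set p. ht f x \<le> k)"
proof -
  obtain p q where "walk f u p (root_of f u)" "\<forall>x \<in> set p. ht f x \<le> ht f u"
    "walk f v q (root_of f v)" "\<forall>x \<in> set q. ht f x \<le> ht f v"
    using climb assms by metis
  then have "walk f u (p @ tl (rev q)) v" "\<forall>x \<in> set p \<union> set q. ht f x \<le> k"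
    using walk_append walk_rev assms by fastforce+
  moreover have "set (p @ tl (rev q)) \<subseteq> set p \<union> set q"
    using set_drop_subset[of 1 "rev q"] by (auto simp: drop_Suc)
  ultimately show ?thesis using walk_imp_path[of f u _ v] by (meson Un_iff subset_iff)
qed

lemma no_cycle: "path f u p v \<Longrightarrow> 3 \<le> length p \<Longrightarrow> adj f v u \<Longrightarrow> False"
  using RF by (auto simp: RF_def acyclic_graph_def)

lemma path_snoc:
  "path f u p v \<Longrightarrow> adj f v w \<Longrightarrow> w \<notin> set p \<Longrightarrow> path f u (p @ [w]) w"
  using RF_adj by (auto simp: path_def walk_def successively_append_iff)

lemma path_Cons:
  "path f u p v \<Longrightarrow> adj f w u \<Longrightarrow> w \<notin> set p \<Longrightarrow> path f w (w # p) v"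
  using RF_adj walk_Cons by (auto simp: path_def)

lemma length_path: "path f u p v \<Longrightarrow> u \<noteq> v \<Longrightarrow> 2 \<le> length p"
  by (cases p; cases "tl p") (auto simp: path_def walk_def)

text \<open>Two adjacent roots would lie in one component and coincide. At positive height,
  \<open>u\<close> and \<open>v\<close> have lower neighbours joined by a path beneath them, and the
  edge between \<open>u\<close> and \<open>v\<close> closes a cycle.\<close>

lemma ht_adj_neq:
  assumes "adj f u v"
  shows "ht f u \<noteq> ht f v"
proof
  assume eq: "ht f u = ht f v"
  note uv = RF_adj[OF assms] root_of_adj[OF assms]
  show False
  proof (cases "ht f u")
    case 0
    then show False using eq uv ht_eq_0_iff root_of_root by metis
  next
    case (Suc k)
    obtain a b where ab: "adj f a u" "ht f a = k" "adj f b v" "ht f b = k"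
      using ex_lower Suc eq uv by metis
    then obtain p where p: "path f a p b" "\<forall>x \<in> set p. ht f x \<le> k"
      using low_path[of a b k] RF_adj root_of_adj uv by fastforce
    then have "u \<notin> set p" "v \<notin> set p" using Suc eq by auto
    then have "path f u (u # p @ [v]) v"
      using path_Cons[OF path_snoc[OF p(1)]] ab adj_sym uv by auto
    moreover have "0 < length p" using p by (auto simp: path_def walk_def)
    then have "3 \<le> length (u # p @ [v])" by (simp add: Suc_le_eq)
    ultimately show False using no_cycle assms adj_sym by blast
  qed
qed

text \<open>Two distinct lower neighbours would be joined by a path beneath \<open>v\<close>, and
  \<open>v\<close> would close it to a cycle.\<close>

lemma lower_unique:
  assumes "adj f a v" "adj f b v" "ht f v = Suc (ht f a)" "ht f v = Suc (ht f b)"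
  shows "a = b"
proof (rule ccontr)
  assume ne: "a \<noteq> b"
  obtain p where p: "path f a p b" "\<forall>x \<in> set p. ht f x \<le> ht f a"
    using low_path[of a b "ht f a"] RF_adj root_of_adj assms by fastforce
  then have "path f a (p @ [v]) v" using path_snoc[OF p(1)] assms by force
  moreover have "3 \<le> length (p @ [v])" using length_path[OF p(1) ne] by simp
  ultimately show False using no_cycle assms adj_sym by blast
qed

theorem RF_is_height: "is_height f (ht f)"
  unfolding is_height_def
proof (intro conjI allI ballI impI)
  fix u v assume "adj f u v"
  then show "ht f u = Suc (ht f v) \<or> ht f v = Suc (ht f u)"
    using ht_adj_neq ht_adj_le adj_sym by (metis le_SucE le_antisym)
next
  fix v assume v: "v \<in> verts f - roots f"
  then obtain k where "ht f v = Suc k" using ht_eq_0_iff not0_implies_Suc by blast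
  then show "\<exists>!u. adj f u v \<and> ht f v = Suc (ht f u)"
    using ex_lower lower_unique v by (metis DiffD1)
qed (use RF_edge RF_roots ht_eq_0_iff in auto)

end

section \<open>Uniqueness of height functions\<close>

lemma is_height_adj:
  "is_height f h \<Longrightarrow> adj f u v \<Longrightarrow> u \<in> verts f \<and> v \<in> verts f \<and> u \<noteq> v"
proof -
  assume "is_height f h" "adj f u v"
  then have "{u, v} \<subseteq> verts f" "card {u, v} = 2" unfolding is_height_def adj_def by blast+
  then show ?thesis by (cases "u = v") auto
qed

lemma is_height_0: "is_height f h \<Longrightarrow> v \<in> verts f \<Longrightarrow> h v = 0 \<longleftrightarrow> v \<in> roots f"
  by (simp add: is_height_def)

lemma is_height_step: "is_height f h \<Longrightarrow> adj f u v \<Longrightarrow> h u = Suc (h v) \<or> h v = Suc (h u)"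
  by (simp add: is_height_def)

lemma is_height_lower:
  "is_height f h \<Longrightarrow> v \<in> verts f \<Longrightarrow> v \<notin> roots f \<Longrightarrow> \<exists>!u. adj f u v \<and> h v = Suc (h u)"
  by (simp add: is_height_def)

lemma is_height_unique:
  assumes "is_height f h" "is_height f h'" "v \<in> verts f"
  shows "h v = h' v"
proof -
  \<comment> \<open>The disjunction makes the claim symmetric. If \<open>h v = k > 0\<close>, a
    lower neighbour has height \<open>k - 1\<close> under both functions, which leaves
    \<open>h' v = k\<close> or \<open>h' v = k - 2\<close>; the latter falls under the induction
    hypothesis because that speaks of values of \<open>h'\<close> too.\<close>
  have "\<forall>v \<in> verts f. h v = k \<or> h' v = k \<longrightarrow> h v = h' v" for k
  proof (induction k rule: less_induct)
    case (less k)
    have *: "h1 v = h2 v" if H: "is_height f h1" "is_height f h2" "v \<in> verts f" "h1 v = k" and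
      IH: "\<And>j w. j < k \<Longrightarrow> w \<in> verts f \<Longrightarrow> h1 w = j \<or> h2 w = j \<Longrightarrow> h1 w = h2 w" for h1 h2 v
    proof (cases k)
      case 0
      then show ?thesis using H is_height_0 by metis
    next
      case (Suc j)
      then have "v \<notin> roots f" using H is_height_0[OF H(1,3)] by simp
      then obtain u where u: "adj f u v" "h1 v = Suc (h1 u)"
        using is_height_lower[OF H(1,3)] by blast
      then have "h2 u = j" using IH[of j u] is_height_adj[OF H(1)] Suc H(4) by auto
      then have "h2 v = k \<or> Suc (h2 v) = j"
        using is_height_step[OF H(2) u(1)] Suc by auto
      then show ?thesis using IH[of "h2 v" v] H Suc by auto
    qed
    show ?case
    proof (intro ballI impI)
      fix v assume "v \<in> verts f" "h v = k \<or> h' v = k"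
      from this(2) show "h v = h' v"
      proof
        assume "h v = k"
        then show ?thesis using *[OF assms(1,2) \<open>v \<in> verts f\<close>] less.IH by blast
      next
        assume "h' v = k"
        then show ?thesis using *[OF assms(2,1) \<open>v \<in> verts f\<close>] less.IH by metis
      qed
    qed
  qed
  then show ?thesis using assms(3) by blast
qed

section \<open>From height functions back to forests\<close>

context
  fixes f :: rforest and h :: "nat \<Rightarrow> nat"
  assumes H: "is_height f h"
begin

text \<open>Edges directed from parent to child; ancestry, the reflexive transitive closure,
  replaces walks.\<close>

definition lower :: "(nat \<times> nat) set" where
  "lower = {(u, v). adj f u v \<and> h v = Suc (h u)}"

lemma lower_ancestor_unique:
  "v \<in> verts f \<Longrightarrow> \<exists>!r. r \<in> roots f \<and> (r, v) \<in> lower\<^sup>*"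
proof (induction "h v" arbitrary: v)
  case 0
  then have "v \<in> roots f" using H by (simp add: is_height_def)
  moreover have "r = v" if "(r, v) \<in> lower\<^sup>*" for r
    using that 0 by (cases rule: rtranclE) (auto simp: lower_def)
  ultimately show ?case by blast
next
  case (Suc k)
  then have nr: "v \<notin> roots f" using is_height_0[OF H Suc.prems] by simp
  then have "\<exists>!u. adj f u v \<and> h v = Suc (h u)" using is_height_lower[OF H Suc.prems] by blast
  then obtain u where u: "(u, v) \<in> lower" "\<And>w. (w, v) \<in> lower \<Longrightarrow> w = u"
    unfolding lower_def by blast
  have "k = h u" "u \<in> verts f" using u(1) Suc is_height_adj[OF H] by (auto simp: lower_def)
  then obtain r where r: "r \<in> roots f" "(r, u) \<in> lower\<^sup>*"
    "\<And>s. s \<in> roots f \<Longrightarrow> (s, u) \<in> lower\<^sup>* \<Longrightarrow> s = r" using Suc by metis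
  have "s = r" if "s \<in> roots f" "(s, v) \<in> lower\<^sup>*" for s
    using that(2,1) by (cases rule: rtranclE) (use u(2) r(3) nr in auto)
  moreover have "(r, v) \<in> lower\<^sup>*" using r u(1) by (meson rtrancl.rtrancl_into_rtrancl)
  ultimately show ?case using r(1) by blast
qed

lemma lower_imp_walk: "(u, v) \<in> lower\<^sup>* \<Longrightarrow> u \<in> verts f \<Longrightarrow> same_component f u v"
proof (induction rule: rtrancl_induct)
  case (step y z)
  then have "adj f y z" by (simp add: lower_def)
  then have "same_component f y z"
    using walk_Cons[OF walk_refl] is_height_adj[OF H] unfolding same_component_def by blast
  then show ?case using same_component_trans step by blast
qed (use same_component_refl in auto)

text \<open>A step away from the root extends the chain of ancestors. On a step towards the root,
  from \<open>u\<close> to \<open>b\<close>, a root above \<open>b\<close> is also above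
  \<open>u\<close>, so uniqueness makes it \<open>r\<close>.\<close>

lemma walk_same_ancestor:
  "walk f u p v \<Longrightarrow> r \<in> roots f \<Longrightarrow> (r, u) \<in> lower\<^sup>* \<Longrightarrow> (r, v) \<in> lower\<^sup>*"
proof (induction p arbitrary: u)
  case (Cons a p)
  show ?case
  proof (cases p)
    case Nil
    then show ?thesis using Cons by (auto simp: walk_def)
  next
    case (Cons b q)
    then have w: "adj f u b" "walk f b p v" using Cons.prems by (auto simp: walk_def)
    have "(r, b) \<in> lower\<^sup>*"
    proof (cases "h b = Suc (h u)")
      case True
      then show ?thesis using w Cons.prems by (auto simp: lower_def intro: rtrancl_into_rtrancl)
    next
      case False
      then have "(b, u) \<in> lower" using w H adj_sym by (auto simp: lower_def is_height_def)
      moreover obtain s where "s \<in> roots f" "(s, b) \<in> lower\<^sup>*"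
        using lower_ancestor_unique is_height_adj[OF H w(1)] by blast
      ultimately show ?thesis
        using lower_ancestor_unique is_height_adj[OF H w(1)] Cons.prems(2,3)
        by (metis rtrancl.rtrancl_into_rtrancl)
    qed
    then show ?thesis using Cons.IH w(2) Cons.prems(2) by blast
  qed
qed (simp add: walk_def)

text \<open>A vertex of greatest height on a cycle has two neighbours there, both necessarily lower,
  but only one lower neighbour is allowed.\<close>

lemma is_height_acyclic: "acyclic_graph f"
  unfolding acyclic_graph_def
proof safe
  fix p u v assume p: "path f u p v" "3 \<le> length p" "adj f v u"
  then have "h ` set p \<noteq> {}" by auto
  then have "Max (h ` set p) \<in> h ` set p" by (intro Max_in) auto
  then obtain x where x: "x \<in> set p" "h x = Max (h ` set p)" by auto
  obtain y z where yz: "y \<noteq> z" "adj f x y" "adj f x z" "y \<in> set p" "z \<in> set p"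
    using cycle_two_neighbours[OF p x(1)] by blast
  then have "h y \<le> h x" "h z \<le> h x" using x by auto
  then have "h x = Suc (h y)" "h x = Suc (h z)" using is_height_step[OF H yz(2)] is_height_step[OF H yz(3)] by auto
  moreover from this have "x \<in> verts f - roots f"
    using is_height_0[OF H, of x] is_height_adj[OF H yz(2)] by simp
  ultimately show False using yz is_height_lower[OF H, of x] adj_sym by (metis DiffD1 DiffD2)
qed

theorem is_height_imp_RF: "verts f = {1..n} \<Longrightarrow> f \<in> RF n"
proof -
  assume V: "verts f = {1..n}"
  have "\<exists>!r. r \<in> roots f \<and> same_component f r v" if "v \<in> verts f" for v
  proof -
    have rv: "roots f \<subseteq> verts f" using H by (simp add: is_height_def)
    have "(r, v) \<in> lower\<^sup>* \<longleftrightarrow> same_component f r v" if "r \<in> roots f" for r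
      using lower_imp_walk walk_same_ancestor[of r _ v r] that rv
      by (auto simp: same_component_def)
    then show ?thesis using lower_ancestor_unique[OF that] by auto
  qed
  then show ?thesis using V H is_height_acyclic by (simp add: RF_def is_height_def)
qed

end

lemma RF_iff: "f \<in> RF n \<longleftrightarrow> verts f = {1..n} \<and> is_height f (ht f)"
proof -
  have "verts f = {1..n}" if "f \<in> RF n" using that unfolding RF_def by blast
  then show ?thesis using RF_is_height is_height_imp_RF by blast
qed

text \<open>The height of a constructed forest need never be computed as a distance: any explicit
  function passing \<open>is_height\<close> is the height.\<close>

lemma ht_eq: "is_height f h \<Longrightarrow> verts f = {1..n} \<Longrightarrow> v \<in> verts f \<Longrightarrow> ht f v = h v"
  using is_height_unique is_height_imp_RF RF_is_height by blast

section \<open>Siblings and their ranks\<close>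

text \<open>The rank is strictly increasing on \<open>S\<close> and takes values in a set of the
  same size.\<close>

lemma rank_bij_betw:
  fixes S :: "'a :: linorder set"
  assumes "finite S"
  shows "bij_betw (\<lambda>v. card {w \<in> S. w \<le> v}) S {1..card S}"
proof -
  let ?rk = "\<lambda>v. card {w \<in> S. w \<le> v}"
  have "?rk v < ?rk w" if "v < w" "w \<in> S" for v w

  proof (intro psubset_card_mono psubsetI)
    have "w \<in> {x \<in> S. x \<le> w}" "w \<notin> {x \<in> S. x \<le> v}" using that by auto
    then show "{x \<in> S. x \<le> v} \<noteq> {x \<in> S. x \<le> w}" by metis
  qed (use that assms in auto)
  then have inj: "inj_on ?rk S" by (metis (no_types, lifting) inj_onI less_irrefl linorder_neqE)
  have "?rk ` S \<subseteq> {1..card S}"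
  proof safe
    fix v assume "v \<in> S"
    then have "{v} \<subseteq> {w \<in> S. w \<le> v}" by auto
    then have "card {v} \<le> ?rk v" using assms by (intro card_mono) auto
    moreover have "?rk v \<le> card S" using assms by (intro card_mono) auto
    ultimately show "?rk v \<in> {1..card S}" by simp
  qed
  moreover have "card (?rk ` S) = card {1..card S}" using inj by (simp add: card_image)
  ultimately show ?thesis using inj by (simp add: bij_betw_def card_subset_eq)
qed

text \<open>The common shape of \<open>first_root\<close>, \<open>next_sibling\<close> and
  \<open>first_child\<close>.\<close>

lemma option_The_eq_Some_iff:
  assumes "\<And>x y. P x \<Longrightarrow> P y \<Longrightarrow> x = y"
  shows "(if \<exists>x. P x then Some (THE x. P x) else None) = Some y \<longleftrightarrow> P y"
  using assms by (auto intro: the_equality theI)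

text \<open>Adding \<open>v\<close> turns \<open>siblings\<close> into classes, each the set of
  roots or the set of children of one vertex, in which \<open>eta\<close> is the rank.\<close>

definition sibs :: "rforest \<Rightarrow> nat \<Rightarrow> nat set" where
  "sibs f v = insert v {w. siblings f v w}"

lemma eta_sibs: "eta f v = card {w \<in> sibs f v. w \<le> v}"
  by (simp add: eta_def sibs_def)

locale forest =
  fixes f :: rforest
  assumes finite_verts: "finite (verts f)"
    and height: "is_height f (ht f)"
begin

lemma roots_verts: "r \<in> roots f \<Longrightarrow> r \<in> verts f"
  using height by (auto simp: is_height_def)

lemma parent_verts: "parent f u v \<Longrightarrow> u \<in> verts f \<and> v \<in> verts f"
  using is_height_adj[OF height] by (auto simp: parent_def)

lemma parent_not_root: "parent f u v \<Longrightarrow> v \<notin> roots f"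
  using is_height_0[OF height] parent_verts by (force simp: parent_def)

lemma adj_iff_parent: "adj f u v \<longleftrightarrow> parent f u v \<or> parent f v u"
  using is_height_step[OF height] adj_sym[of f u v] by (auto simp: parent_def)

lemma ex1_parent: "v \<in> verts f \<Longrightarrow> v \<notin> roots f \<Longrightarrow> \<exists>!u. parent f u v"
  using is_height_lower[OF height] by (simp add: parent_def)

lemma parent_unique: "parent f u w \<Longrightarrow> parent f v w \<Longrightarrow> u = v"
  using ex1_parent parent_not_root parent_verts by (metis (no_types))

lemma ex_parent: "v \<in> verts f \<Longrightarrow> v \<notin> roots f \<Longrightarrow> \<exists>u. parent f u v"
  using ex1_parent by blast

lemma sibs_root: "v \<in> roots f \<Longrightarrow> sibs f v = roots f"
  using parent_not_root by (auto simp: sibs_def siblings_def)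

lemma sibs_child: "parent f u v \<Longrightarrow> sibs f v = {w. parent f u w}"
  using parent_not_root parent_unique unfolding sibs_def siblings_def by blast

lemma vert_cases:
  assumes "v \<in> verts f"
  obtains (root) "v \<in> roots f" "sibs f v = roots f"
    | (child) u where "parent f u v" "sibs f v = {w. parent f u w}"
  using assms ex_parent sibs_root sibs_child by metis

lemma sibs_eq: "v \<in> verts f \<Longrightarrow> w \<in> sibs f v \<Longrightarrow> sibs f w = sibs f v"
  by (elim vert_cases) (auto simp: sibs_root sibs_child)

lemma sibs_verts: "v \<in> verts f \<Longrightarrow> sibs f v \<subseteq> verts f"
  by (elim vert_cases) (auto simp: roots_verts parent_verts)

lemma ht_eq_0_iff_root: "v \<in> verts f \<Longrightarrow> ht f v = 0 \<longleftrightarrow> v \<in> roots f"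
  using is_height_0[OF height] .

lemma ht_sibs: "v \<in> verts f \<Longrightarrow> w \<in> sibs f v \<Longrightarrow> ht f w = ht f v"
proof (erule vert_cases)
  assume "w \<in> sibs f v" "v \<in> roots f" "sibs f v = roots f"
  then show ?thesis using ht_eq_0_iff_root[of v] ht_eq_0_iff_root[of w] roots_verts by simp
qed (simp add: parent_def)

lemma self_in_sibs: "v \<in> sibs f v"
  by (simp add: sibs_def)

lemma eta_bij_betw:
  assumes "v \<in> verts f"
  shows "bij_betw (eta f) (sibs f v) {1..card (sibs f v)}"
proof -
  have "finite (sibs f v)" using sibs_verts[OF assms] finite_verts by (rule finite_subset)
  then have "bij_betw (\<lambda>x. card {w \<in> sibs f v. w \<le> x}) (sibs f v) {1..card (sibs f v)}"
    by (rule rank_bij_betw)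
  then show ?thesis
    by (rule bij_betw_cong[THEN iffD1, rotated]) (simp add: eta_sibs sibs_eq[OF assms])
qed

lemma eta_inj: "v \<in> verts f \<Longrightarrow> w \<in> sibs f v \<Longrightarrow> eta f w = eta f v \<Longrightarrow> w = v"
  using eta_bij_betw self_in_sibs by (metis bij_betw_def inj_onD)

lemma eta_pos: "v \<in> verts f \<Longrightarrow> 1 \<le> eta f v"
  using eta_bij_betw self_in_sibs by (metis atLeastAtMost_iff bij_betw_apply)

lemma eta_ex:
  assumes "v \<in> verts f" "1 \<le> k" "k \<le> eta f v"
  shows "\<exists>w \<in> sibs f v. eta f w = k"
proof -
  have "eta f v \<in> {1..card (sibs f v)}"
    using eta_bij_betw[OF assms(1)] self_in_sibs by (rule bij_betw_apply)
  then have "k \<in> eta f ` sibs f v" using eta_bij_betw[OF assms(1)] assms by (simp add: bij_betw_def)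
  then show ?thesis by auto
qed

lemma first_root_eq_Some_iff: "first_root f = Some r \<longleftrightarrow> r \<in> roots f \<and> eta f r = 1"
  unfolding first_root_def Bex_def
  by (rule option_The_eq_Some_iff) (metis eta_inj sibs_root roots_verts)

lemma next_sibling_eq_Some_iff:
  "v \<in> verts f \<Longrightarrow> next_sibling f v = Some w \<longleftrightarrow> w \<in> sibs f v \<and> eta f w = eta f v + 1"
proof -
  assume v: "v \<in> verts f"
  have *: "siblings f v w \<and> eta f w = eta f v + 1 \<longleftrightarrow> w \<in> sibs f v \<and> eta f w = eta f v + 1" for w
    by (auto simp: sibs_def siblings_def)
  show ?thesis unfolding next_sibling_def *
    by (rule option_The_eq_Some_iff) (metis eta_inj sibs_eq sibs_verts subsetD v)
qed

lemma first_child_eq_Some_iff: "first_child f v = Some w \<longleftrightarrow> parent f v w \<and> eta f w = 1"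
  unfolding first_child_def
  by (rule option_The_eq_Some_iff) (metis eta_inj sibs_child parent_verts mem_Collect_eq)

lemma first_child_eq_None_iff: "first_child f v = None \<longleftrightarrow> (\<forall>w. \<not> parent f v w)"
proof
  assume N: "first_child f v = None"
  show "\<forall>w. \<not> parent f v w"
  proof safe
    fix w assume w: "parent f v w"
    then obtain x where "x \<in> sibs f w" "eta f x = 1"
      using eta_ex[of w 1] eta_pos parent_verts by blast
    then have "first_child f v = Some x" using first_child_eq_Some_iff w sibs_child by auto
    then show False using N by simp
  qed
next
  assume "\<forall>w. \<not> parent f v w"
  then show "first_child f v = None" by (simp add: first_child_def)
qed

text \<open>Ranks fill an initial interval, so any further sibling would force one of rank 2, which
  is the next sibling.\<close>

lemma next_sibling_None_imp:
  assumes "v \<in> verts f" "next_sibling f v = None" "eta f v = 1"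
  shows "sibs f v = {v}"
proof -
  have "w = v" if w: "w \<in> sibs f v" for w
  proof (rule ccontr)
    assume "w \<noteq> v"
    have wv: "w \<in> verts f" using w assms sibs_verts by blast
    then have "2 \<le> eta f w" using eta_pos[OF wv] eta_inj[OF assms(1) w] \<open>w \<noteq> v\<close> assms(3) by force
    then obtain x where "x \<in> sibs f w" "eta f x = 2" using eta_ex[OF wv, of 2] by auto
    then have "next_sibling f v = Some x"
      using next_sibling_eq_Some_iff[OF assms(1)] assms(3) sibs_eq[OF assms(1) w] by simp
    then show False using assms by simp
  qed
  then show ?thesis using self_in_sibs by blast
qed

section \<open>The binary tree of a forest\<close>

text \<open>The edges of the binary tree, directed away from its root.\<close>

definition succ :: "(nat \<times> nat) set" where
  "succ = {(v, w). v \<in> verts f \<and> (next_sibling f v = Some w \<or> first_child f v = Some w)}"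

lemma succ_verts: "(v, w) \<in> succ \<Longrightarrow> v \<in> verts f \<and> w \<in> verts f"
  using sibs_verts[of v] parent_verts[of v w]
  by (auto simp: succ_def next_sibling_eq_Some_iff first_child_eq_Some_iff)

text \<open>A left child keeps the height and raises the rank, a right child raises the height. This
  lexicographic growth excludes cycles, so that the recursion behind \<open>binary_subtree\<close>
  terminates.\<close>

lemma succ_increases:
  "(v, w) \<in> succ \<Longrightarrow> ht f v < ht f w \<or> ht f v = ht f w \<and> eta f v < eta f w"
  by (auto simp: succ_def next_sibling_eq_Some_iff first_child_eq_Some_iff parent_def ht_sibs)

lemma trancl_succ_increases:
  "(v, w) \<in> succ\<^sup>+ \<Longrightarrow> ht f v < ht f w \<or> ht f v = ht f w \<and> eta f v < eta f w"
  by (induction rule: trancl_induct) (use succ_increases in fastforce)+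

lemma acyclic_succ: "acyclic succ"
  using trancl_succ_increases by (fastforce simp: acyclic_def)

lemma wf_succ: "wf (succ\<inverse>)"
proof -
  have "succ \<subseteq> verts f \<times> verts f" using succ_verts by auto
  then have "finite succ" using finite_verts by (meson finite_SigmaI finite_subset)
  then show ?thesis using acyclic_succ by (rule finite_acyclic_wf_converse)
qed

text \<open>A next sibling has rank at least 2 and a first child has rank 1, so both edges into
  \<open>w\<close> are of the same kind, and each kind determines its source.\<close>

lemma succ_unique:
  assumes "(v, w) \<in> succ" "(v', w) \<in> succ"
  shows "v = v'"
proof -
  have *: "v \<in> verts f" "v' \<in> verts f" "w \<in> verts f" using assms succ_verts by auto
  have pos: "eta f v > 0" "eta f v' > 0" using * eta_pos by force+
  consider "next_sibling f v = Some w" "next_sibling f v' = Some w"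
    | "first_child f v = Some w" "first_child f v' = Some w"
    using assms pos * by (auto simp: succ_def next_sibling_eq_Some_iff first_child_eq_Some_iff)
  then show ?thesis
  proof cases
    case 1
    then have a: "w \<in> sibs f v" "w \<in> sibs f v'" "eta f v' = eta f v"
      using * by (auto simp: next_sibling_eq_Some_iff)
    then have "v' \<in> sibs f v" using sibs_eq * self_in_sibs by metis
    then show ?thesis using eta_inj * a by metis
  next
    case 2
    then show ?thesis using parent_unique by (auto simp: first_child_eq_Some_iff)
  qed
qed

lemma binary_subtree_ex: "v \<in> verts f \<Longrightarrow> \<exists>t. binary_subtree f (Some v) t"
proof (induction v rule: wf_induct_rule[OF wf_succ])
  case (1 v)
  have "\<exists>t. binary_subtree f x t" if "x = next_sibling f v \<or> x = first_child f v" for x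
  proof (cases x)
    case (Some w)
    then have "(v, w) \<in> succ" using that 1(2) by (auto simp: succ_def)
    then show ?thesis using 1 succ_verts Some by auto
  qed (auto intro: binary_subtree.empty)
  from this[of "next_sibling f v"] this[of "first_child f v"] show ?case
    using binary_subtree.node by blast
qed

lemma binary_subtree_det: "binary_subtree f x t \<Longrightarrow> binary_subtree f x t' \<Longrightarrow> t' = t"
proof (induction arbitrary: t' rule: binary_subtree.induct)
  case empty
  then show ?case by (cases rule: binary_subtree.cases) auto
next
  case (node v l r)
  from node.prems show ?case by (cases rule: binary_subtree.cases) (use node.IH in auto)
qed

lemma binary_tree_eqI: "binary_subtree f (first_root f) t \<Longrightarrow> binary_tree f = t"
  unfolding binary_tree_def using binary_subtree_det by (intro the_equality) auto

lemma binary_subtree_first_root: "binary_subtree f (first_root f) (binary_tree f)"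
proof -
  have "\<exists>t. binary_subtree f (first_root f) t"
    using binary_subtree_ex first_root_eq_Some_iff roots_verts
    by (cases "first_root f") (auto intro: binary_subtree.empty)
  then show ?thesis using binary_tree_eqI by blast
qed

text \<open>Turns coverage and disjointness of subtrees into questions of reachability along
  \<open>succ\<close>.\<close>

lemma set_binary_subtree:
  "binary_subtree f x t \<Longrightarrow> set_option x \<subseteq> verts f \<Longrightarrow> set_tree t = succ\<^sup>* `` set_option x"
proof (induction rule: binary_subtree.induct)
  case (node v l r)
  have "set_option (next_sibling f v) \<union> set_option (first_child f v) = succ `` {v}"
    using node.prems by (auto simp: succ_def elem_set)
  moreover from this have "set_option (next_sibling f v) \<subseteq> verts f" "set_option (first_child f v) \<subseteq> verts f"
    using succ_verts by blast+
  ultimately have "set_tree l \<union> set_tree r = succ\<^sup>* `` (succ `` {v})"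
    using node.IH by (metis Image_Un)
  also have "insert v (succ\<^sup>* `` (succ `` {v})) = succ\<^sup>* `` {v}"
    by (auto intro: converse_rtrancl_into_rtrancl elim: converse_rtranclE)
  finally show ?case by simp
qed simp

lemma succ_linear:
  "(u, w) \<in> succ\<^sup>* \<Longrightarrow> (v, w) \<in> succ\<^sup>* \<Longrightarrow> (u, v) \<in> succ\<^sup>* \<or> (v, u) \<in> succ\<^sup>*"
proof (induction rule: rtrancl_induct)
  case (step y z)
  from step.prems show ?case
  proof (cases rule: rtranclE)
    case base
    then show ?thesis using step by (meson rtrancl.rtrancl_into_rtrancl)
  next
    case (step y')
    then show ?thesis using succ_unique step.IH step.hyps by metis
  qed
qed simp

lemma first_child_not_next_sibling:
  assumes "v \<in> verts f" "next_sibling f v = Some a"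
  shows "first_child f v \<noteq> Some a"
  using assms eta_pos[of v] by (auto simp: next_sibling_eq_Some_iff first_child_eq_Some_iff)

text \<open>Every vertex has at most one predecessor under \<^term>\<open>succ\<close>, so a vertex in both subtrees
  would make one of their roots reachable from the other, and hence \<open>v\<close> from itself.\<close>

lemma distinct_binary_subtree:
  "binary_subtree f x t \<Longrightarrow> set_option x \<subseteq> verts f \<Longrightarrow> distinct (inorder t)"
proof (induction rule: binary_subtree.induct)
  case (node v l r)
  have v: "v \<in> verts f" using node.prems by simp
  have sv: "(v, a) \<in> succ" if "a \<in> set_option (next_sibling f v) \<union> set_option (first_child f v)" for a
    using that v by (auto simp: succ_def elem_set)
  then have sub: "set_option (next_sibling f v) \<subseteq> verts f" "set_option (first_child f v) \<subseteq> verts f"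
    using succ_verts by blast+
  note sets = set_binary_subtree[OF node.hyps(1) sub(1)] set_binary_subtree[OF node.hyps(2) sub(2)]
  have irr: "(a, v) \<notin> succ\<^sup>*" if "(v, a) \<in> succ" for a
    using that acyclic_succ by (meson acyclic_def rtrancl_into_trancl2)
  have "v \<notin> set_tree l" "v \<notin> set_tree r" using sets irr sv by auto
  moreover have "set_tree l \<inter> set_tree r = {}"
  proof (rule ccontr)
    assume "set_tree l \<inter> set_tree r \<noteq> {}"
    then obtain w a b where w: "(a, w) \<in> succ\<^sup>*" "(b, w) \<in> succ\<^sup>*"
      "next_sibling f v = Some a" "first_child f v = Some b"
      using sets by (auto simp: elem_set)
    then have ab: "(v, a) \<in> succ" "(v, b) \<in> succ" "a \<noteq> b"
      using sv first_child_not_next_sibling[OF v] by auto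
    have "(c, d) \<notin> succ\<^sup>*" if cd: "(v, c) \<in> succ" "(v, d) \<in> succ" "c \<noteq> d" for c d
    proof
      assume "(c, d) \<in> succ\<^sup>*"
      then show False
        by (cases rule: rtranclE) (use cd irr succ_unique in blast)+
    qed
    then show False using succ_linear[OF w(1,2)] ab by metis
  qed
  ultimately show ?case using node sub by auto
qed simp

text \<open>Descent on height and rank: the predecessor is the sibling of rank one less, or the
  parent if the rank is 1.\<close>

lemma reachable_from_first_root:
  "v \<in> verts f \<Longrightarrow> \<exists>r. first_root f = Some r \<and> (r, v) \<in> succ\<^sup>*"
proof (induction "(ht f v, eta f v)" arbitrary: v rule: wf_induct_rule[OF wf_lex_prod[OF wf_less_than wf_less_than]])
  case (1 v)
  show ?case
  proof (cases "v \<in> roots f \<and> eta f v = 1")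
    case True
    then show ?thesis using first_root_eq_Some_iff by auto
  next
    case False
    have "\<exists>u. (u, v) \<in> succ"
    proof (cases "eta f v = 1")
      case True
      then obtain u where "parent f u v" using False ex_parent 1(2) by blast
      then have "(u, v) \<in> succ" using True parent_verts
        by (simp add: succ_def first_child_eq_Some_iff)
      then show ?thesis ..
    next
      case False
      then have "1 \<le> eta f v - 1" "eta f v - 1 + 1 = eta f v" using eta_pos[OF 1(2)] by auto
      then obtain u where u: "u \<in> sibs f v" "eta f v = eta f u + 1"
        using eta_ex[OF 1(2), of "eta f v - 1"] by auto
      then have "u \<in> verts f" "v \<in> sibs f u" using sibs_verts sibs_eq self_in_sibs 1(2) by blast+
      then have "(u, v) \<in> succ" using u by (simp add: succ_def next_sibling_eq_Some_iff)
      then show ?thesis ..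
    qed
    then obtain u where u: "(u, v) \<in> succ" ..
    then show ?thesis using 1(1)[of u] succ_verts succ_increases[OF u]
      by (auto intro: rtrancl_into_rtrancl)
  qed
qed

lemma set_binary_tree: "set_tree (binary_tree f) = verts f"
proof -
  have sub: "set_option (first_root f) \<subseteq> verts f"
    using first_root_eq_Some_iff roots_verts by (auto simp: elem_set)
  have "set_tree (binary_tree f) = succ\<^sup>* `` set_option (first_root f)"
    using set_binary_subtree[OF binary_subtree_first_root sub] .
  moreover have "succ\<^sup>* `` set_option (first_root f) \<subseteq> verts f"
  proof (intro subsetI, elim ImageE)
    fix r v assume "r \<in> set_option (first_root f)" "(r, v) \<in> succ\<^sup>*"
    from this(2,1) show "v \<in> verts f" by (cases rule: rtranclE) (use sub succ_verts in auto)
  qed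
  ultimately show ?thesis using reachable_from_first_root by (force simp: elem_set)
qed

lemma distinct_binary_tree: "distinct (inorder (binary_tree f))"
  using distinct_binary_subtree[OF binary_subtree_first_root] first_root_eq_Some_iff roots_verts
  by (auto simp: elem_set)

lemma size_binary_tree: "size (binary_tree f) = card (verts f)"
  using distinct_binary_tree set_binary_tree distinct_card set_inorder length_inorder by metis

end

section \<open>The right spine\<close>

primrec spine :: "'a tree \<Rightarrow> 'a list" where
  "spine \<langle>\<rangle> = []"
| "spine \<langle>l, v, r\<rangle> = v # spine r"

text \<open>Extends the right spine at its end; on binary trees this is the effect of attaching a
  leaf to \<open>first_leaf f\<close>.\<close>

primrec snoc :: "'a tree \<Rightarrow> 'a \<Rightarrow> 'a tree" where
  "snoc \<langle>\<rangle> m = \<langle>\<langle>\<rangle>, m, \<langle>\<rangle>\<rangle>"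
| "snoc \<langle>l, v, r\<rangle> m = \<langle>l, v, snoc r m\<rangle>"

lemma spine_snoc: "spine (snoc t m) = spine t @ [m]"
  by (induction t) auto

lemma spine_eq_Nil_iff: "spine t = [] \<longleftrightarrow> t = \<langle>\<rangle>"
  by (cases t) auto

lemma set_spine: "set (spine t) \<subseteq> set_tree t"
  by (induction t) auto

lemma spine_map_tree: "spine (map_tree \<psi> t) = map \<psi> (spine t)"
  by (induction t) auto

context forest
begin

lemma binary_subtree_eq_Leaf_iff: "binary_subtree f x t \<Longrightarrow> t = \<langle>\<rangle> \<longleftrightarrow> x = None"
  by (auto elim: binary_subtree.cases)

text \<open>The right child in the binary tree is the first child in the forest, so the spine
  follows vertices of rank 1 down to one without children.\<close>

lemma spine_first_path:
  "binary_subtree f x t \<Longrightarrow> x = Some v \<Longrightarrow> v \<in> verts f \<Longrightarrow> eta f v = 1 \<Longrightarrow>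
   hd (spine t) = v \<and> successively (parent f) (spine t) \<and> leaf f (last (spine t)) \<and>
   (\<forall>u \<in> set (spine t). eta f u = 1)"
proof (induction arbitrary: v rule: binary_subtree.induct)
  case (node u l r)
  then have v: "v = u" by simp
  show ?case
  proof (cases "first_child f u")
    case None
    then have "r = \<langle>\<rangle>" using binary_subtree_eq_Leaf_iff node.hyps by blast
    then show ?thesis using None node.prems v first_child_eq_None_iff by (simp add: leaf_def)
  next
    case (Some w)
    then have w: "parent f u w" "eta f w = 1" using first_child_eq_Some_iff by auto
    have "r \<noteq> \<langle>\<rangle>" using Some binary_subtree_eq_Leaf_iff[OF node.hyps(2)] by simp
    then have "spine r \<noteq> []" by (simp add: spine_eq_Nil_iff)
    then show ?thesis using node.IH(2)[OF Some] w parent_verts node.prems v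
      by (auto simp: successively_Cons)
  qed
qed simp

text \<open>Each vertex of \<open>q\<close> after the first is a child of rank 1, hence the first
  child of the one before, so the path is forced.\<close>

lemma spine_unique:
  "binary_subtree f x t \<Longrightarrow> x = Some (hd q) \<Longrightarrow> q \<noteq> [] \<Longrightarrow> successively (parent f) q \<Longrightarrow>
   leaf f (last q) \<Longrightarrow> \<forall>u \<in> set q. eta f u = 1 \<Longrightarrow> spine t = q"
proof (induction arbitrary: q rule: binary_subtree.induct)
  case (node u l r)
  then obtain q' where q: "q = u # q'" by (cases q) auto
  show ?case
  proof (cases q')
    case Nil
    then have "first_child f u = None" using node.prems q first_child_eq_None_iff
      by (simp add: leaf_def)
    then have "r = \<langle>\<rangle>" using binary_subtree_eq_Leaf_iff[OF node.hyps(2)] by simp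
    then show ?thesis using Nil q by simp
  next
    case (Cons w q'')
    then have "first_child f u = Some (hd q')"
      using node.prems q by (simp add: first_child_eq_Some_iff)
    then show ?thesis using node.IH(2)[of q'] node.prems q Cons by simp
  qed
qed simp

text \<open>A path leaving the root can never turn back towards it.\<close>

lemma path_descends:
  "path f u (u # p) v \<Longrightarrow> (\<forall>w. parent f w u \<longrightarrow> w \<notin> set p) \<Longrightarrow> successively (parent f) (u # p)"
proof (induction p arbitrary: u)
  case (Cons w p)
  then have "adj f u w" by (simp add: path_def walk_def)
  then have uw: "parent f u w" using Cons.prems(2) adj_iff_parent by auto
  have "path f w (w # p) v" using Cons.prems by (auto simp: path_def walk_def)
  moreover have "\<forall>x. parent f x w \<longrightarrow> x \<notin> set p"
    using Cons.prems(1) uw parent_unique by (auto simp: path_def)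
  ultimately show ?case using Cons.IH uw by simp
qed simp

text \<open>Heights rise at each parent step, so no vertex repeats.\<close>

lemma descending_path:
  assumes "successively (parent f) p" "p \<noteq> []" "hd p \<in> verts f"
  shows "path f (hd p) p (last p)"
proof -
  have "successively (\<lambda>u v. ht f u < ht f v) p"
    using assms(1) by (rule successively_mono) (simp add: parent_def)
  then have "sorted_wrt (\<lambda>u v. ht f u < ht f v) p"
    by (subst (asm) successively_conv_sorted_wrt) (auto simp: transp_def)
  then have "distinct p" by (induction p) auto
  moreover have "set p \<subseteq> verts f" using assms
  proof (induction p)
    case (Cons u q)
    then show ?case using parent_verts[of u "hd q"] by (cases "q = []") (auto simp: successively_Cons)
  qed simp
  moreover have "successively (adj f) p"
    using assms(1) by (rule successively_mono) (simp add: parent_def)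
  ultimately show ?thesis using assms by (simp add: path_def walk_def)
qed

text \<open>Justifies the \<open>THE\<close> in \<open>first_path\<close>: the spine is such a path,
  and a competitor starts at a root, must descend, and is then forced by
  \<open>spine_unique\<close>.\<close>

lemma first_path_eq:
  assumes "verts f \<noteq> {}"
  shows "first_path f = spine (binary_tree f)"
  unfolding first_path_def
proof (rule the_equality)
  obtain r where r: "first_root f = Some r" using assms reachable_from_first_root by blast
  then have rr: "r \<in> roots f" "eta f r = 1" by (auto simp: first_root_eq_Some_iff)
  note b = binary_subtree_first_root[unfolded r]
  let ?s = "spine (binary_tree f)"
  have s: "hd ?s = r" "successively (parent f) ?s" "leaf f (last ?s)" "\<forall>u \<in> set ?s. eta f u = 1"
    using spine_first_path[OF b] rr roots_verts by auto
  moreover have "?s \<noteq> []" using b binary_subtree_eq_Leaf_iff spine_eq_Nil_iff by blast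
  ultimately have "path f r ?s (last ?s)" using descending_path[of ?s] rr roots_verts by simp
  then show "\<exists>r v. r \<in> roots f \<and> leaf f v \<and> path f r ?s v \<and> (\<forall>u \<in> set ?s. eta f u = 1)"
    using s rr by blast
  fix p assume "\<exists>r v. r \<in> roots f \<and> leaf f v \<and> path f r p v \<and> (\<forall>u \<in> set p. eta f u = 1)"
  then obtain r' v where p: "r' \<in> roots f" "leaf f v" "path f r' p v" "\<forall>u \<in> set p. eta f u = 1"
    by blast
  then obtain q where q: "p = r' # q" by (cases p) (auto simp: path_def walk_def)
  have "successively (parent f) p" using path_descends p q parent_not_root by blast
  moreover have "first_root f = Some r'" using p q by (simp add: first_root_eq_Some_iff)
  moreover have "last p = v" using p by (simp add: path_def walk_def)
  ultimately show "p = ?s" using spine_unique[OF binary_subtree_first_root, of p] p q by simp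
qed

text \<open>Identifies the first path of a modified forest without computing its binary
  tree.\<close>

lemma first_path_eqI:
  assumes "q \<noteq> []" "hd q \<in> roots f" "successively (parent f) q" "leaf f (last q)"
    "\<forall>u \<in> set q. eta f u = 1"
  shows "first_path f = q"
proof -
  have "first_root f = Some (hd q)" using assms by (simp add: first_root_eq_Some_iff)
  then show ?thesis
    using spine_unique[OF binary_subtree_first_root, of q] assms first_path_eq by (auto simp: leaf_def)
qed

lemma first_path:
  assumes "verts f \<noteq> {}"
  shows "first_path f \<noteq> []" "hd (first_path f) \<in> roots f" "successively (parent f) (first_path f)"
    "leaf f (first_leaf f)" "\<forall>u \<in> set (first_path f). eta f u = 1"
proof -
  obtain r where r: "first_root f = Some r" using assms reachable_from_first_root by blast
  then have rr: "r \<in> roots f" "eta f r = 1" by (auto simp: first_root_eq_Some_iff)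
  note b = binary_subtree_first_root[unfolded r]
  show "first_path f \<noteq> []" "hd (first_path f) \<in> roots f" "successively (parent f) (first_path f)"
    "leaf f (first_leaf f)" "\<forall>u \<in> set (first_path f). eta f u = 1"
    unfolding first_leaf_def first_path_eq[OF assms]
    using spine_first_path[OF b] rr roots_verts binary_subtree_eq_Leaf_iff[OF b]
    by (auto simp: spine_eq_Nil_iff)
qed

text \<open>\<open>snoc\<close> gives \<open>m\<close> an empty left subtree, and the left child is
  the next sibling.\<close>

lemma binary_subtree_snoc_next_sibling:
  "binary_subtree f x t \<Longrightarrow> t = snoc s m \<Longrightarrow> next_sibling f m = None"
proof (induction arbitrary: s rule: binary_subtree.induct)
  case empty
  then show ?case by (cases s) auto
next
  case (node v l r)
  show ?case
  proof (cases s)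
    case Leaf
    then show ?thesis using node binary_subtree_eq_Leaf_iff by auto
  next
    case (Node l' v' r')
    then show ?thesis using node by auto
  qed
qed

end

section \<open>Columns of the Dyck word\<close>

text \<open>One less than the entry with index \<open>i\<close>. If \<open>Up i\<close> does not
  occur in \<open>w\<close>, all right steps of \<open>w\<close> are counted.\<close>

definition column :: "nat \<Rightarrow> step list \<Rightarrow> nat" where
  "column i w = count_list (takeWhile (\<lambda>s. s \<noteq> Up i) w) Rightwards"

lemma column_Nil [simp]: "column i [] = 0"
  and column_Cons [simp]:
    "column i (s # w) = (if s = Up i then 0 else (if s = Rightwards then 1 else 0) + column i w)"
  by (auto simp: column_def)

lemma column_append:
  "column i (v @ w) = (if Up i \<in> set v then column i v else count_list v Rightwards + column i w)"
  by (induction v) auto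

lemma Up_in_dyck_word [simp]: "Up i \<in> set (dyck_word t) \<longleftrightarrow> i \<in> set_tree t"
  by (induction t) auto

lemma count_dyck_word [simp]: "count_list (dyck_word t) Rightwards = size t"
  by (induction t) auto

text \<open>The right step of \<open>i\<close> itself is never counted, since it follows
  \<open>Up i\<close>.\<close>

lemma column_less_size: "i \<in> set_tree t \<Longrightarrow> column i (dyck_word t) < size t"
  by (induction t) (auto simp: column_append)

lemma dyck_word_snoc: "dyck_word (snoc t m) = dyck_word t @ [Up m, Rightwards]"
  by (induction t) auto

text \<open>At the root the column is 0, which forces a single vertex. Inside the left subtree, the
  right step of \<open>v\<close> would be a second one after \<open>Up i\<close>. So
  \<open>i\<close> is sought in the right subtree.\<close>

lemma last_column_snoc:
  "i \<in> set_tree t \<Longrightarrow> Suc (column i (dyck_word t)) = size t \<Longrightarrow> \<exists>s. t = snoc s i"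
proof (induction t)
  case (Node l v r)
  consider "i = v" | "i \<noteq> v" "i \<in> set_tree l" | "i \<noteq> v" "i \<notin> set_tree l" "i \<in> set_tree r"
    using Node.prems by auto
  then show ?case
  proof cases
    case 1
    then have "\<langle>l, v, r\<rangle> = snoc \<langle>\<rangle> i" using Node.prems(2) by simp
    then show ?thesis ..
  next
    case 2
    then show ?thesis using Node.prems(2) column_less_size[of i l] by (auto simp: column_append)
  next
    case 3
    then obtain s where "r = snoc s i" using Node.prems(2) Node.IH(2) by (auto simp: column_append)
    then have "\<langle>l, v, r\<rangle> = snoc \<langle>l, v, s\<rangle> i" by simp
    then show ?thesis ..
  qed
qed simp

text \<open>Injectivity keeps \<open>Up (\<psi> i)\<close> from occurring anywhere but in the place
  of \<open>Up i\<close>.\<close>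

lemma column_map_tree:
  "inj_on \<psi> (insert i (set_tree t)) \<Longrightarrow>
   column (\<psi> i) (dyck_word (map_tree \<psi> t)) = column i (dyck_word t)"
proof (induction t)
  case (Node l v r)
  have "inj_on \<psi> (insert i (set_tree l))" "inj_on \<psi> (insert i (set_tree r))"
    using Node.prems by (auto elim!: inj_on_subset)
  moreover have "\<psi> v = \<psi> i \<longleftrightarrow> v = i" using Node.prems by (auto simp: inj_on_def)
  moreover have "\<psi> i \<in> \<psi> ` set_tree l \<longleftrightarrow> i \<in> set_tree l"
    using Node.prems by (auto simp: inj_on_def)
  ultimately show ?case using Node.IH by (simp add: column_append tree.set_map)
qed simp

lemma phi_column:
  "phi f = map (\<lambda>i. Suc (column i (dyck_word (binary_tree f)))) [1..<card (verts f) + 1]"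
  by (simp add: phi_def column_def)

section \<open>Equivalence of forests\<close>

locale forest_iso = f: forest f + g: forest g for f g +
  fixes \<psi> :: "nat \<Rightarrow> nat"
  assumes bij: "bij_betw \<psi> (verts f) (verts g)"
    and adj_iso: "u \<in> verts f \<Longrightarrow> v \<in> verts f \<Longrightarrow> adj g (\<psi> u) (\<psi> v) \<longleftrightarrow> adj f u v"
    and ht_iso: "v \<in> verts f \<Longrightarrow> ht g (\<psi> v) = ht f v"
    and eta_iso: "v \<in> verts f \<Longrightarrow> eta g (\<psi> v) = eta f v"
begin

lemma image_verts: "\<psi> ` verts f = verts g"
  using bij by (simp add: bij_betw_def)

lemma inj_verts: "u \<in> verts f \<Longrightarrow> v \<in> verts f \<Longrightarrow> \<psi> u = \<psi> v \<longleftrightarrow> u = v"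
  using bij by (auto simp: bij_betw_def inj_on_def)

lemma in_verts: "v \<in> verts f \<Longrightarrow> \<psi> v \<in> verts g"
  using image_verts by blast

lemma parent_iso: "u \<in> verts f \<Longrightarrow> v \<in> verts f \<Longrightarrow> parent g (\<psi> u) (\<psi> v) \<longleftrightarrow> parent f u v"
  by (simp add: parent_def adj_iso ht_iso)

text \<open>\<open>forest_equiv\<close> does not mention roots; they are recovered as the vertices
  of height 0.\<close>

lemma roots_iso: "v \<in> verts f \<Longrightarrow> \<psi> v \<in> roots g \<longleftrightarrow> v \<in> roots f"
  using f.ht_eq_0_iff_root g.ht_eq_0_iff_root ht_iso in_verts by metis

lemma siblings_iso:
  assumes "u \<in> verts f" "v \<in> verts f"
  shows "siblings g (\<psi> u) (\<psi> v) \<longleftrightarrow> siblings f u v"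
proof -
  have "(\<exists>w. parent g w (\<psi> u) \<and> parent g w (\<psi> v)) \<longleftrightarrow> (\<exists>w. parent f w u \<and> parent f w v)"
    using assms parent_iso image_verts f.parent_verts g.parent_verts by (metis imageE)
  then show ?thesis using assms by (simp add: siblings_def roots_iso inj_verts)
qed

lemma sibs_iso:
  assumes "u \<in> verts f" "v \<in> verts f"
  shows "\<psi> u \<in> sibs g (\<psi> v) \<longleftrightarrow> u \<in> sibs f v"
  using assms siblings_iso inj_verts by (auto simp: sibs_def)

text \<open>Surjectivity of \<open>\<psi>\<close> onto \<open>verts g\<close> excludes a value of
  \<open>b\<close> without a partner in \<open>a\<close>.\<close>

lemma map_option_eqI:
  assumes "\<And>w. a = Some w \<Longrightarrow> w \<in> verts f" "\<And>w. b = Some w \<Longrightarrow> w \<in> verts g"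
    "\<And>w. w \<in> verts f \<Longrightarrow> b = Some (\<psi> w) \<longleftrightarrow> a = Some w"
  shows "b = map_option \<psi> a"
proof (cases b)
  case None
  then show ?thesis using assms by (cases a) auto
next
  case (Some w')
  then obtain w where "w' = \<psi> w" "w \<in> verts f" using assms(2) image_verts by blast
  then have "a = Some w" using assms(3) Some by blast
  then show ?thesis using Some \<open>w' = \<psi> w\<close> by simp
qed

lemma next_sibling_iso:
  assumes v: "v \<in> verts f"
  shows "next_sibling g (\<psi> v) = map_option \<psi> (next_sibling f v)"
proof (rule map_option_eqI)
  show "w \<in> verts f" if "next_sibling f v = Some w" for w
    using that f.next_sibling_eq_Some_iff v f.sibs_verts by blast
  show "w \<in> verts g" if "next_sibling g (\<psi> v) = Some w" for w
    using that g.next_sibling_eq_Some_iff v in_verts g.sibs_verts by blast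
qed (use v in_verts in \<open>simp add: f.next_sibling_eq_Some_iff g.next_sibling_eq_Some_iff sibs_iso eta_iso\<close>)

lemma first_child_iso:
  assumes v: "v \<in> verts f"
  shows "first_child g (\<psi> v) = map_option \<psi> (first_child f v)"
proof (rule map_option_eqI)
  show "w \<in> verts f" if "first_child f v = Some w" for w
    using that f.first_child_eq_Some_iff f.parent_verts by blast
  show "w \<in> verts g" if "first_child g (\<psi> v) = Some w" for w
    using that g.first_child_eq_Some_iff g.parent_verts by blast
qed (use v in \<open>simp add: f.first_child_eq_Some_iff g.first_child_eq_Some_iff parent_iso eta_iso\<close>)

lemma first_root_iso: "first_root g = map_option \<psi> (first_root f)"
proof (rule map_option_eqI)
  show "w \<in> verts f" if "first_root f = Some w" for w
    using that f.first_root_eq_Some_iff f.roots_verts by blast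
  show "w \<in> verts g" if "first_root g = Some w" for w
    using that g.first_root_eq_Some_iff g.roots_verts by blast
qed (simp add: f.first_root_eq_Some_iff g.first_root_eq_Some_iff roots_iso eta_iso)

lemma binary_subtree_iso:
  "binary_subtree f x t \<Longrightarrow> set_option x \<subseteq> verts f \<Longrightarrow>
   binary_subtree g (map_option \<psi> x) (map_tree \<psi> t)"
proof (induction rule: binary_subtree.induct)
  case (node v l r)
  then have v: "v \<in> verts f" by simp
  have "set_option (next_sibling f v) \<subseteq> verts f"
    using f.next_sibling_eq_Some_iff[OF v] f.sibs_verts[OF v] by (auto simp: elem_set)
  moreover have "set_option (first_child f v) \<subseteq> verts f"
    using f.first_child_eq_Some_iff f.parent_verts by (auto simp: elem_set)
  ultimately show ?case
    using node.IH next_sibling_iso[OF v] first_child_iso[OF v] by (simp add: binary_subtree.node)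
qed (simp add: binary_subtree.empty)

lemma binary_tree_iso: "binary_tree g = map_tree \<psi> (binary_tree f)"
proof (rule g.binary_tree_eqI)
  have "set_option (first_root f) \<subseteq> verts f"
    using f.first_root_eq_Some_iff f.roots_verts by (auto simp: elem_set)
  then show "binary_subtree g (first_root g) (map_tree \<psi> (binary_tree f))"
    unfolding first_root_iso using f.binary_subtree_first_root by (rule binary_subtree_iso[rotated])
qed

text \<open>The entry of \<open>phi g\<close> at index \<open>\<psi> i\<close> is that of
  \<open>phi f\<close> at \<open>i\<close>, so equivalence only permutes entries.\<close>

lemma phi_iso:
  assumes "verts f = {1..n}" "verts g = {1..n}"
  shows "mset (phi g) = mset (phi f)"
proof -
  have mset_phi: "mset (phi e) = image_mset (\<lambda>i. Suc (column i (dyck_word (binary_tree e)))) (mset_set {1..n})"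
    if "verts e = {1..n}" for e
    using that by (simp add: phi_column atLeastLessThanSuc_atLeastAtMost del: upt_Suc)
  have inj: "inj_on \<psi> {1..n}" "\<psi> ` {1..n} = {1..n}" using bij assms by (auto simp: bij_betw_def)
  have "mset (phi g) = image_mset (\<lambda>i. Suc (column (\<psi> i) (dyck_word (binary_tree g)))) (mset_set {1..n})"
    unfolding mset_phi[OF assms(2)] using inj
    by (subst inj(2)[symmetric], subst image_mset_mset_set[symmetric])
       (auto simp: multiset.map_comp o_def)
  also have "\<dots> = mset (phi f)"
    unfolding mset_phi[OF assms(1)]
  proof (rule image_mset_cong)
    fix i assume "i \<in># mset_set {1..n}"
    then have "insert i (set_tree (binary_tree f)) = {1..n}"
      using f.set_binary_tree assms by auto
    then show "Suc (column (\<psi> i) (dyck_word (binary_tree g))) = Suc (column i (dyck_word (binary_tree f)))"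
      using column_map_tree inj(1) by (metis binary_tree_iso)
  qed
  finally show ?thesis .
qed

end

lemma RF_imp_forest: "f \<in> RF n \<Longrightarrow> forest f"
  by (simp add: forest_def RF_iff)

lemma RF_verts: "f \<in> RF n \<Longrightarrow> verts f = {1..n}"
  by (simp add: RF_iff)

lemma RF_rel_iso: "(f, g) \<in> RF_rel n \<longleftrightarrow> f \<in> RF n \<and> g \<in> RF n \<and> (\<exists>\<psi>. forest_iso f g \<psi>)"
  unfolding RF_rel_def forest_equiv_def forest_iso_def forest_iso_axioms_def
  using RF_imp_forest by blast

lemma equiv_RF_rel: "equiv (RF n) (RF_rel n)"
proof (rule equivI)
  show "RF_rel n \<subseteq> RF n \<times> RF n" by (auto simp: RF_rel_def)
  show "refl_on (RF n) (RF_rel n)"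
  proof (rule refl_onI)
    fix f assume "f \<in> RF n"
    moreover have "f \<sim>\<^sub>F f" unfolding forest_equiv_def by (intro exI[of _ id]) auto
    ultimately show "(f, f) \<in> RF_rel n" by (simp add: RF_rel_def)
  qed
  show "sym (RF_rel n)"
  proof (rule symI)
    fix f g assume "(f, g) \<in> RF_rel n"
    then obtain \<psi> where fg: "f \<in> RF n" "g \<in> RF n" and "forest_iso f g \<psi>"
      unfolding RF_rel_iso by blast
    then interpret forest_iso f g \<psi> by simp
    let ?i = "inv_into (verts f) \<psi>"
    have i: "?i v \<in> verts f" "\<psi> (?i v) = v" if "v \<in> verts g" for v
      using that image_verts by (auto simp: inv_into_into f_inv_into_f)
    have "forest_iso g f ?i"
    proof unfold_locales
      show "bij_betw ?i (verts g) (verts f)" using bij by (rule bij_betw_inv_into)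
      fix u v assume u: "u \<in> verts g"
      show "ht f (?i u) = ht g u" "eta f (?i u) = eta g u"
        using ht_iso[OF i(1)[OF u]] eta_iso[OF i(1)[OF u]] i(2)[OF u] by simp_all
      assume v: "v \<in> verts g"
      show "adj f (?i u) (?i v) \<longleftrightarrow> adj g u v"
        using adj_iso[OF i(1)[OF u] i(1)[OF v]] i(2)[OF u] i(2)[OF v] by simp
    qed
    then show "(g, f) \<in> RF_rel n" using fg unfolding RF_rel_iso by blast
  qed
  show "trans (RF_rel n)"
  proof (rule transI)
    fix e f g assume "(e, f) \<in> RF_rel n" "(f, g) \<in> RF_rel n"
    then obtain \<psi> \<chi> where efg: "e \<in> RF n" "g \<in> RF n" and "forest_iso e f \<psi>" "forest_iso f g \<chi>"
      unfolding RF_rel_iso by blast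
    then interpret A: forest_iso e f \<psi> by simp
    interpret B: forest_iso f g \<chi> by fact
    have "forest_iso e g (\<chi> \<circ> \<psi>)"
    proof unfold_locales
      show "bij_betw (\<chi> \<circ> \<psi>) (verts e) (verts g)" using A.bij B.bij by (rule bij_betw_trans)
    qed (simp_all add: A.in_verts A.adj_iso A.ht_iso A.eta_iso B.adj_iso B.ht_iso B.eta_iso)
    then show "(e, g) \<in> RF_rel n" using efg unfolding RF_rel_iso by blast
  qed
qed

section \<open>Invariance of \<open>RF_k\<close> under equivalence\<close>

lemma PF_mset_cong:
  assumes "mset a = mset b"
  shows "a \<in> PF n \<longleftrightarrow> b \<in> PF n"
proof -
  have "sort a = sort b" using assms by (metis sorted_list_of_multiset_mset)
  then show ?thesis using assms by (simp add: PF_def mset_eq_length[OF assms] mset_eq_setD[OF assms])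
qed

lemma PF_missing_mset_cong: "mset a = mset b \<Longrightarrow> a \<in> PF_missing n k \<longleftrightarrow> b \<in> PF_missing n k"
  using PF_mset_cong[of a b n] mset_eq_setD[of a b] by (simp add: PF_missing_def)

lemma RF_k_RF_rel:
  assumes "(f, g) \<in> RF_rel n" "f \<in> RF_k n k"
  shows "g \<in> RF_k n k"
proof -
  obtain \<psi> where fg: "f \<in> RF n" "g \<in> RF n" and "forest_iso f g \<psi>"
    using assms by (auto simp: RF_rel_iso)
  then interpret forest_iso f g \<psi> by simp
  have "mset (phi g) = mset (phi f)" using phi_iso fg RF_verts by blast
  then show ?thesis
    using assms(2) fg PF_missing_mset_cong[of "phi g" "phi f"] by (simp add: RF_k_def split: if_splits)
qed

section \<open>Attaching and detaching a leaf\<close>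

text \<open>The vertex \<open>x\<close> is left free because a detached leaf is put back at a vertex
  not yet known to be \<open>first_leaf\<close>.\<close>

definition attach :: "rforest \<Rightarrow> nat \<Rightarrow> nat \<Rightarrow> rforest" where
  "attach f x m = \<lparr>verts = insert m (verts f), edges = insert {x, m} (edges f), roots = roots f\<rparr>"

lemma forest_plus_attach: "forest_plus f = attach f (first_leaf f) (card (verts f) + 1)"
  by (simp add: forest_plus_def attach_def Let_def)

lemma adj_attach: "adj (attach f x m) u v \<longleftrightarrow> adj f u v \<or> u = x \<and> v = m \<or> u = m \<and> v = x"
  by (auto simp: adj_def attach_def doubleton_eq_iff)

context forest
begin

lemma is_height_attach:
  assumes "m \<notin> verts f" "x \<in> verts f"
  shows "is_height (attach f x m) (\<lambda>v. if v = m then Suc (ht f x) else ht f v)"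
proof -
  let ?g = "attach f x m" and ?h = "\<lambda>v. if v = m then Suc (ht f x) else ht f v"
  have xm: "x \<noteq> m" using assms by auto
  have adjm: "u \<noteq> m \<and> v \<noteq> m" if "adj f u v" for u v
    using is_height_adj[OF height that] assms by auto
  have V: "verts ?g = insert m (verts f)" "roots ?g = roots f" by (simp_all add: attach_def)
  show ?thesis
    unfolding is_height_def
  proof (intro conjI ballI allI impI)
    fix e assume "e \<in> edges ?g"
    then show "e \<subseteq> verts ?g" "card e = 2"
      using height assms xm by (auto simp: attach_def is_height_def)
  next
    fix u v assume "adj ?g u v"
    then show "?h u = Suc (?h v) \<or> ?h v = Suc (?h u)"
      using is_height_step[OF height] adjm xm by (auto simp: adj_attach)
  next
    fix v assume v: "v \<in> verts ?g - roots ?g"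
    show "\<exists>!u. adj ?g u v \<and> ?h v = Suc (?h u)"
    proof (cases "v = m")
      case True
      then show ?thesis using adjm xm by (intro ex1I[of _ x]) (auto simp: adj_attach)
    next
      case False
      then have "\<exists>!u. adj f u v \<and> ht f v = Suc (ht f u)"
        using is_height_lower[OF height] v V by auto
      moreover have "adj ?g u v \<and> ?h v = Suc (?h u) \<longleftrightarrow> adj f u v \<and> ht f v = Suc (ht f u)" for u
        using adjm[of u v] False by (auto simp: adj_attach)
      ultimately show ?thesis by simp
    qed
  qed (use V assms roots_verts ht_eq_0_iff_root in auto)
qed

end

text \<open>That \<open>x\<close> is a leaf makes \<open>m\<close> an only child, so no sibling set
  and no rank of an old vertex changes. The heights are assumptions because \<open>ht_eq\<close>
  asks for the labels \<open>{1..n}\<close>; \<open>attached_of_RF\<close> supplies them.\<close>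

locale attached = f: forest f + g: forest "attach f x m" for f x m +
  assumes new: "m \<notin> verts f" and x: "x \<in> verts f"
    and ht_old: "v \<in> verts f \<Longrightarrow> ht (attach f x m) v = ht f v"
    and ht_new: "ht (attach f x m) m = Suc (ht f x)"
    and leaf_x: "leaf f x"
begin

abbreviation "g \<equiv> attach f x m"

lemma verts_attach: "verts g = insert m (verts f)" and roots_attach: "roots g = roots f"
  by (simp_all add: attach_def)

lemma parent_attach: "parent g u v \<longleftrightarrow> parent f u v \<or> u = x \<and> v = m"
proof -
  have "adj f u v \<Longrightarrow> u \<in> verts f \<and> v \<in> verts f" using is_height_adj[OF f.height] by blast
  then show ?thesis using new x by (auto simp: parent_def adj_attach ht_old ht_new)
qed

lemma sibs_attach: "v \<in> verts f \<Longrightarrow> sibs g v = sibs f v"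
  using leaf_x new f.parent_verts
  by (auto simp: sibs_def siblings_def parent_attach roots_attach leaf_def)

lemma sibs_new: "sibs g m = {m}"
  using g.sibs_child[of x m] leaf_x by (auto simp: parent_attach leaf_def)

lemma eta_attach: "v \<in> verts f \<Longrightarrow> eta g v = eta f v"
  by (simp add: eta_sibs sibs_attach)

lemma eta_new: "eta g m = 1"
proof -
  have "{w \<in> sibs g m. w \<le> m} = {m}" using sibs_new by auto
  then show ?thesis by (simp add: eta_sibs)
qed

lemma siblings_sibs: "siblings e v w \<longleftrightarrow> w \<in> sibs e v \<and> w \<noteq> v"
  by (auto simp: sibs_def siblings_def)

lemma next_sibling_attach: "v \<in> verts f \<Longrightarrow> next_sibling g v = next_sibling f v"
proof -
  assume v: "v \<in> verts f"
  then have "siblings g v w \<and> eta g w = eta g v + 1 \<longleftrightarrow> siblings f v w \<and> eta f w = eta f v + 1" for w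
    using f.sibs_verts[OF v] by (auto simp: siblings_sibs sibs_attach eta_attach)
  then show ?thesis by (simp add: next_sibling_def)
qed

lemma next_sibling_new: "next_sibling g m = None"
  using sibs_new by (simp add: next_sibling_def siblings_sibs)

lemma first_child_attach: "v \<noteq> x \<Longrightarrow> first_child g v = first_child f v"
proof -
  assume "v \<noteq> x"
  then have "parent g v w \<and> eta g w = 1 \<longleftrightarrow> parent f v w \<and> eta f w = 1" for w
    using f.parent_verts[of v w] by (auto simp: parent_attach eta_attach)
  then show ?thesis by (simp add: first_child_def)
qed

lemma first_child_x: "first_child g x = Some m"
  by (simp add: g.first_child_eq_Some_iff parent_attach eta_new)

lemma first_child_new: "first_child g m = None"
  using new x f.parent_verts by (auto simp: g.first_child_eq_None_iff parent_attach)

lemma first_root_attach: "first_root g = first_root f"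
proof -
  have "r \<in> roots g \<and> eta g r = 1 \<longleftrightarrow> r \<in> roots f \<and> eta f r = 1" for r
    using f.roots_verts by (auto simp: roots_attach eta_attach)
  then show ?thesis by (simp add: first_root_def Bex_def)
qed

lemma binary_subtree_attach:
  "binary_subtree f y t \<Longrightarrow> set_tree t \<subseteq> verts f \<Longrightarrow> x \<notin> set_tree t \<Longrightarrow> binary_subtree g y t"
proof (induction rule: binary_subtree.induct)
  case (node v l r)
  then show ?case
    using binary_subtree.node[of g v l r] next_sibling_attach[of v] first_child_attach[of v] by auto
qed (simp add: binary_subtree.empty)

text \<open>Distinct labels keep \<open>x\<close>, the end of the spine, out of the left subtrees
  along it; these stay as they are, and only the spine is rebuilt.\<close>

lemma binary_subtree_attach_snoc:
  "binary_subtree f y t \<Longrightarrow> t \<noteq> \<langle>\<rangle> \<Longrightarrow> distinct (inorder t) \<Longrightarrow> set_tree t \<subseteq> verts f \<Longrightarrow>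
   last (spine t) = x \<Longrightarrow> binary_subtree g y (snoc t m)"
proof (induction rule: binary_subtree.induct)
  case (node v l r)
  have "x \<in> set (spine \<langle>l, v, r\<rangle>)" using node.prems by (metis last_in_set spine_eq_Nil_iff)
  then have xl: "x \<notin> set_tree l" using node.prems set_spine[of r] by auto
  then have l: "binary_subtree g (next_sibling g v) l"
    using binary_subtree_attach[OF node.hyps(1)] node.prems next_sibling_attach[of v] by simp
  have r: "binary_subtree g (first_child g v) (snoc r m)"
  proof (cases "r = \<langle>\<rangle>")
    case True
    then have "v = x" using node.prems by simp
    then show ?thesis using True first_child_x next_sibling_new first_child_new
        binary_subtree.node[of g m "\<langle>\<rangle>" "\<langle>\<rangle>"] binary_subtree.empty[of g] by simp
  next
    case False
    then have "last (spine r) = x" using node.prems by (simp add: spine_eq_Nil_iff)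
    moreover from this have "x \<in> set_tree r"
      using False set_spine by (metis last_in_set spine_eq_Nil_iff subsetD)
    then have "v \<noteq> x" using node.prems by auto
    ultimately show ?thesis using node.IH(2) False node.prems by (simp add: first_child_attach)
  qed
  show ?case using binary_subtree.node[OF l r] by simp
qed simp

lemma binary_tree_attach:
  assumes "first_leaf f = x"
  shows "binary_tree g = snoc (binary_tree f) m"
proof (rule g.binary_tree_eqI)
  have "verts f \<noteq> {}" using x by auto
  then have "last (spine (binary_tree f)) = x" "binary_tree f \<noteq> \<langle>\<rangle>"
    using assms f.first_path_eq f.set_binary_tree by (auto simp: first_leaf_def)
  then show "binary_subtree g (first_root g) (snoc (binary_tree f) m)"
    unfolding first_root_attach
    using f.binary_subtree_first_root f.distinct_binary_tree f.set_binary_tree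
    by (intro binary_subtree_attach_snoc) auto
qed

lemma phi_attach:
  assumes "first_leaf f = x" "verts f = {1..n}" "m = n + 1"
  shows "phi g = phi f @ [n + 1]"
proof -
  have S: "set_tree (binary_tree f) = {1..n}" "size (binary_tree f) = n"
    using f.set_binary_tree f.size_binary_tree assms by auto
  have D: "dyck_word (binary_tree g) = dyck_word (binary_tree f) @ [Up m, Rightwards]"
    using binary_tree_attach[OF assms(1)] dyck_word_snoc by metis
  have "column i (dyck_word (binary_tree g)) = column i (dyck_word (binary_tree f))" if "i \<in> {1..n}" for i
    using that S by (simp add: D column_append)
  \<comment> \<open>All \<open>n\<close> right steps of the old word precede the new up
    step.\<close>
  moreover have "column m (dyck_word (binary_tree g)) = n"
    unfolding D column_append using S assms(3) by simp
  moreover have "phi f = map (\<lambda>i. Suc (column i (dyck_word (binary_tree f)))) [1..<n + 1]"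
    using assms(2) by (simp add: phi_column)
  moreover have "phi g = map (\<lambda>i. Suc (column i (dyck_word (binary_tree g)))) ([1..<n + 1] @ [m])"
    using assms verts_attach by (simp add: phi_column)
  ultimately show ?thesis using assms(3) by (simp del: upt_Suc)
qed

end

lemma attached_of_RF:
  assumes "f \<in> RF n" "leaf f x"
  shows "attach f x (n + 1) \<in> RF (n + 1)" "attached f x (n + 1)"
proof -
  interpret forest f using assms RF_imp_forest by blast
  have n: "n + 1 \<notin> verts f" "x \<in> verts f" using assms RF_verts by (auto simp: leaf_def)
  have V: "verts (attach f x (n + 1)) = {1..n + 1}" using RF_verts[OF assms(1)] by (auto simp: attach_def)
  note h = is_height_attach[OF n]
  show R: "attach f x (n + 1) \<in> RF (n + 1)" using is_height_imp_RF[OF h V] .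
  interpret g: forest "attach f x (n + 1)" using RF_imp_forest[OF R] .
  show "attached f x (n + 1)"
  proof
    show "ht (attach f x (n + 1)) v = ht f v" if "v \<in> verts f" for v
      using ht_eq[OF h V, of v] that n V by (auto simp: attach_def)
    show "ht (attach f x (n + 1)) (n + 1) = Suc (ht f x)"
      using ht_eq[OF h V, of "n + 1"] by (simp add: attach_def)
  qed (use n assms in auto)
qed

text \<open>The set of roots is kept, so the deleted vertex must not be a root.\<close>

definition detach :: "rforest \<Rightarrow> nat \<Rightarrow> rforest" where
  "detach g m = \<lparr>verts = verts g - {m}, edges = {e \<in> edges g. m \<notin> e}, roots = roots g\<rparr>"

text \<open>A leaf is no vertex's lower neighbour, so the old heights still serve.\<close>

lemma (in forest) is_height_detach:
  assumes "leaf f m" "m \<notin> roots f"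
  shows "is_height (detach f m) (ht f)"
proof -
  let ?h = "detach f m"
  have adj: "adj ?h u v \<longleftrightarrow> adj f u v \<and> u \<noteq> m \<and> v \<noteq> m" for u v
    by (auto simp: detach_def adj_def)
  have V: "verts ?h = verts f - {m}" "roots ?h = roots f" by (simp_all add: detach_def)
  show ?thesis
    unfolding is_height_def
  proof (intro conjI ballI allI impI)
    fix v assume "v \<in> verts ?h - roots ?h"
    then have v: "v \<in> verts f" "v \<noteq> m" "v \<notin> roots f" using V by auto
    have "adj ?h u v \<and> ht f v = Suc (ht f u) \<longleftrightarrow> adj f u v \<and> ht f v = Suc (ht f u)" for u
      using adj v assms by (auto simp: leaf_def parent_def)
    then show "\<exists>!u. adj ?h u v \<and> ht f v = Suc (ht f u)"
      using is_height_lower[OF height v(1,3)] by simp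
  next
    fix e assume "e \<in> edges ?h"
    then have "e \<in> edges f" "m \<notin> e" by (auto simp: detach_def)
    moreover from this have "e \<subseteq> verts f" "card e = 2" using height by (simp_all add: is_height_def)
    ultimately show "e \<subseteq> verts ?h" "card e = 2" using V by auto
  next
    fix u v assume "adj ?h u v"
    then show "ht f u = Suc (ht f v) \<or> ht f v = Suc (ht f u)"
      using adj is_height_step[OF height] by blast
  qed (use V assms roots_verts ht_eq_0_iff_root in auto)
qed

text \<open>A leaf has no children, so each edge at \<open>m\<close> leads to its unique
  parent.\<close>

lemma (in forest) attach_detach:
  assumes "leaf f m" "parent f p m"
  shows "attach (detach f m) p m = f"
proof -
  have "e = {p, m}" if e: "e \<in> edges f" "m \<in> e" for e
  proof -
    have "card e = 2" using e height by (simp add: is_height_def)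
    then obtain q where q: "e = {q, m}" using e(2) by (auto simp: card_2_iff)
    then have "parent f q m" using e assms adj_iff_parent[of q m] by (auto simp: adj_def leaf_def)
    then show ?thesis using parent_unique assms(2) q by blast
  qed
  moreover have "{p, m} \<in> edges f" using assms(2) by (simp add: parent_def adj_def)
  ultimately have "insert {p, m} {e \<in> edges f. m \<notin> e} = edges f" by blast
  moreover have "m \<in> verts f" using assms(1) by (simp add: leaf_def)
  ultimately show ?thesis by (cases f) (auto simp: attach_def detach_def)
qed

section \<open>Relabelling\<close>

definition relabel :: "(nat \<Rightarrow> nat) \<Rightarrow> rforest \<Rightarrow> rforest" where
  "relabel \<sigma> f = \<lparr>verts = \<sigma> ` verts f, edges = (`) \<sigma> ` edges f, roots = \<sigma> ` roots f\<rparr>"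

lemma adj_relabel:
  assumes "is_height f h" "inj_on \<sigma> (verts f)" "u \<in> verts f" "v \<in> verts f"
  shows "adj (relabel \<sigma> f) (\<sigma> u) (\<sigma> v) \<longleftrightarrow> adj f u v"
proof -
  have "\<sigma> ` e = \<sigma> ` {u, v} \<longleftrightarrow> e = {u, v}" if "e \<in> edges f" for e
    using assms that by (intro inj_on_image_eq_iff) (auto simp: is_height_def)
  then show ?thesis unfolding adj_def relabel_def by auto
qed

lemma is_height_relabel:
  assumes h: "is_height f h" and inj: "inj_on \<sigma> (verts f)"
  shows "is_height (relabel \<sigma> f) (h \<circ> inv_into (verts f) \<sigma>)"
proof -
  let ?g = "relabel \<sigma> f" and ?h = "h \<circ> inv_into (verts f) \<sigma>"
  have V: "verts ?g = \<sigma> ` verts f" "roots ?g = \<sigma> ` roots f" by (simp_all add: relabel_def)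
  have hs: "?h (\<sigma> v) = h v" if "v \<in> verts f" for v using that inj by simp
  have rv: "roots f \<subseteq> verts f" using h by (simp add: is_height_def)
  have e: "e \<subseteq> verts ?g \<and> card e = 2" if "e \<in> edges ?g" for e
  proof -
    have "e \<in> (`) \<sigma> ` edges f" using that by (simp add: relabel_def)
    then obtain d where d: "e = \<sigma> ` d" "d \<in> edges f" by (rule imageE)
    then have "d \<subseteq> verts f" "card d = 2" using h by (auto simp: is_height_def)
    then show ?thesis using d V inj by (auto simp: card_image inj_on_subset)
  qed
  have adj_image: "\<exists>u' \<in> verts f. \<exists>v' \<in> verts f. u = \<sigma> u' \<and> v = \<sigma> v'" if "adj ?g u v" for u v
    using e[of "{u, v}"] that V by (auto simp: adj_def)
  show ?thesis
    unfolding is_height_def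
  proof (intro conjI ballI allI impI)
    fix u v assume "adj ?g u v"
    then show "?h u = Suc (?h v) \<or> ?h v = Suc (?h u)"
      using adj_image adj_relabel[OF h inj] is_height_step[OF h] hs by metis
  next
    fix v' assume "v' \<in> verts ?g - roots ?g"
    then obtain v where v: "v \<in> verts f" "v \<notin> roots f" "v' = \<sigma> v" using V by auto
    obtain u where u: "adj f u v" "h v = Suc (h u)"
      and uniq: "\<And>w. adj f w v \<Longrightarrow> h v = Suc (h w) \<Longrightarrow> w = u"
      using is_height_lower[OF h v(1,2)] by blast
    have "u \<in> verts f" using is_height_adj[OF h u(1)] by blast
    show "\<exists>!u. adj ?g u v' \<and> ?h v' = Suc (?h u)"
    proof (rule ex1I[of _ "\<sigma> u"])
      show "adj ?g (\<sigma> u) v' \<and> ?h v' = Suc (?h (\<sigma> u))"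
        using u v \<open>u \<in> verts f\<close> adj_relabel[OF h inj] inj by simp
      fix w assume w: "adj ?g w v' \<and> ?h v' = Suc (?h w)"
      then obtain w' where w': "w' \<in> verts f" "w = \<sigma> w'" using adj_image by blast
      then have "adj f w' v" using w v adj_relabel[OF h inj] by blast
      moreover have "h v = Suc (h w')" using w w' v inj by simp
      ultimately show "w = \<sigma> u" using uniq w' by blast
    qed
  next
    fix v' assume "v' \<in> verts ?g"
    then obtain v where v: "v \<in> verts f" "v' = \<sigma> v" using V by auto
    have "\<sigma> v \<in> \<sigma> ` roots f \<longleftrightarrow> v \<in> roots f" using rv inj v by (auto simp: inj_on_def)
    then show "?h v' = 0 \<longleftrightarrow> v' \<in> roots ?g" using v hs is_height_0[OF h v(1)] V by simp
  qed (use e V rv in auto)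
qed

text \<open>\<open>eta\<close> is a rank within \<open>sibs\<close>, so \<open>\<sigma>\<close> need
  only be increasing on each sibling set, not on all labels.\<close>

lemma relabel_iso:
  assumes f: "f \<in> RF n" and bij: "bij_betw \<sigma> {1..n} {1..n}"
    and mono: "\<And>v. v \<in> verts f \<Longrightarrow> strict_mono_on (sibs f v) \<sigma>"
  shows "relabel \<sigma> f \<in> RF n" "forest_iso f (relabel \<sigma> f) \<sigma>"
proof -
  let ?g = "relabel \<sigma> f"
  interpret f: forest f using f by (rule RF_imp_forest)
  have vf: "verts f = {1..n}" using f by (rule RF_verts)
  have inj: "inj_on \<sigma> (verts f)" and vg: "verts ?g = {1..n}"
    using bij vf by (auto simp: bij_betw_def relabel_def)
  note h = is_height_relabel[OF f.height inj]
  show R: "?g \<in> RF n" using is_height_imp_RF[OF h vg] .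
  interpret g: forest ?g using R by (rule RF_imp_forest)
  have img: "verts ?g = \<sigma> ` verts f" by (simp add: relabel_def)
  have ht: "ht ?g (\<sigma> v) = ht f v" if "v \<in> verts f" for v
    using ht_eq[OF h vg, of "\<sigma> v"] that inj img by simp
  have adj: "adj ?g (\<sigma> u) (\<sigma> v) \<longleftrightarrow> adj f u v" if "u \<in> verts f" "v \<in> verts f" for u v
    using adj_relabel[OF f.height inj that] .
  have sibs: "sibs ?g (\<sigma> v) = \<sigma> ` sibs f v" if v: "v \<in> verts f" for v
    using v
  proof (cases rule: f.vert_cases)
    case root
    then have "\<sigma> v \<in> roots ?g" by (simp add: relabel_def)
    then show ?thesis using root g.sibs_root by (simp add: relabel_def)
  next
    case (child u)
    have u: "u \<in> verts f" using child f.parent_verts by blast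
    then have p: "parent ?g (\<sigma> u) (\<sigma> w) \<longleftrightarrow> parent f u w" if "w \<in> verts f" for w
      using that adj ht by (simp add: parent_def)
    then have "sibs ?g (\<sigma> v) = {w. parent ?g (\<sigma> u) w}" using child v g.sibs_child by blast
    also have "\<dots> = \<sigma> ` {w. parent f u w}"
    proof (intro equalityI subsetI)
      fix w' assume "w' \<in> {w. parent ?g (\<sigma> u) w}"
      moreover from this have "w' \<in> \<sigma> ` verts f" using g.parent_verts img by blast
      ultimately show "w' \<in> \<sigma> ` {w. parent f u w}" using p by blast
    next
      fix w' assume "w' \<in> \<sigma> ` {w. parent f u w}"
      then show "w' \<in> {w. parent ?g (\<sigma> u) w}" using p f.parent_verts by blast
    qed
    finally show ?thesis using child by simp
  qed
  have "eta ?g (\<sigma> v) = eta f v" if v: "v \<in> verts f" for v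
  proof -
    have "\<sigma> w \<le> \<sigma> v \<longleftrightarrow> w \<le> v" if "w \<in> sibs f v" for w
      using strict_mono_on_leD strict_mono_on_less_eq mono[OF v] that f.self_in_sibs by blast
    then have "{w \<in> sibs ?g (\<sigma> v). w \<le> \<sigma> v} = \<sigma> ` {w \<in> sibs f v. w \<le> v}"
      using sibs[OF v] by auto
    moreover have "inj_on \<sigma> {w \<in> sibs f v. w \<le> v}"
      using inj f.sibs_verts[OF v] by (auto elim: inj_on_subset)
    ultimately show ?thesis by (simp add: eta_sibs card_image)
  qed
  then show "forest_iso f ?g \<sigma>"
    using bij vf vg adj ht by unfold_locales simp_all
qed

section \<open>The classes in \<open>RF_k\<close>\<close>

text \<open>Entries of a parking function are bounded by its length, so sorting leaves
  \<open>n + 1\<close> in the last place, where it meets its bound exactly.\<close>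

lemma PF_snoc:
  assumes n: "length a = n"
  shows "a @ [n + 1] \<in> PF (n + 1) \<longleftrightarrow> a \<in> PF n"
proof -
  have bound: "x \<le> n" if "b \<in> PF n" "x \<in> set b" for b x n
  proof -
    have "length (sort b) = n" "x \<in> set (sort b)" using that by (simp_all add: PF_def)
    then obtain i where "i < n" "x = sort b ! i" by (metis in_set_conv_nth)
    then have "x \<le> i + 1" using that by (simp add: PF_def)
    then show ?thesis using \<open>i < n\<close> by simp
  qed
  have iff: "a @ [n + 1] \<in> PF (n + 1) \<longleftrightarrow> a \<in> PF n" if "\<forall>x \<in> set a. x \<le> n + 1"
  proof -
    have "sort (a @ [n + 1]) = sort a @ [n + 1]"
      using that by (intro properties_for_sort) (auto simp: sorted_append)
    then show ?thesis using n by (auto simp: PF_def nth_append less_Suc_eq)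
  qed
  show ?thesis
  proof
    assume *: "a @ [n + 1] \<in> PF (n + 1)"
    then have "\<forall>x \<in> set a. x \<le> n + 1" using bound by (metis Un_iff set_append)
    then show "a \<in> PF n" using iff * by blast
  next
    assume *: "a \<in> PF n"
    then have "\<forall>x \<in> set a. x \<le> n + 1" using bound by fastforce
    then show "a @ [n + 1] \<in> PF (n + 1)" using iff * by blast
  qed
qed

text \<open>As \<open>k \<le> n\<close>, the appended entry is among the required ones and differs
  from \<open>k\<close>.\<close>

lemma PF_missing_snoc:
  assumes "length a = n" "k \<le> n"
  shows "a @ [n + 1] \<in> PF_missing (n + 1) k \<longleftrightarrow> a \<in> PF_missing n k"
proof -
  have "{k + 1..n + 1} = insert (n + 1) {k + 1..n}" using assms by auto
  then have "{k + 1..n + 1} \<subseteq> set (a @ [n + 1]) \<longleftrightarrow> {k + 1..n} \<subseteq> set a" by auto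
  then show ?thesis using PF_snoc[OF assms(1)] assms(2) by (auto simp: PF_missing_def)
qed

lemma forest_plus_RF:
  assumes f: "f \<in> RF n" and "1 \<le> n"
  shows "forest_plus f \<in> RF (n + 1)" "phi (forest_plus f) = phi f @ [n + 1]"
proof -
  interpret forest f using f by (rule RF_imp_forest)
  have vf: "verts f = {1..n}" using f by (rule RF_verts)
  then have "leaf f (first_leaf f)" using assms by (intro first_path) auto
  note att = attached_of_RF[OF f this]
  interpret attached f "first_leaf f" "n + 1" by (rule att)
  have "forest_plus f = attach f (first_leaf f) (n + 1)" using vf by (simp add: forest_plus_attach)
  then show "forest_plus f \<in> RF (n + 1)" "phi (forest_plus f) = phi f @ [n + 1]"
    using att(1) phi_attach vf by simp_all
qed

lemma forest_plus_RF_k: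
  assumes f: "f \<in> RF n" and "1 \<le> k" "k \<le> n"
  shows "forest_plus f \<in> RF_k (n + 1) k \<longleftrightarrow> f \<in> RF_k n k"
proof -
  have "length (phi f) = n" using RF_verts[OF f] by (simp add: phi_def)
  then show ?thesis
    using f forest_plus_RF[OF f] PF_missing_snoc[of "phi f" n k] assms by (simp add: RF_k_def)
qed

text \<open>Inverts \<open>forest_plus\<close>: deleting \<open>n + 1\<close> leaves a forest with
  first path \<open>q\<close>, and attaching the leaf again restores \<open>g\<close>.\<close>

lemma forest_plus_surj:
  assumes g: "g \<in> RF (n + 1)" and path: "first_path g = q @ [n + 1]" "q \<noteq> []"
    and alone: "sibs g (n + 1) = {n + 1}"
  shows "\<exists>f \<in> RF n. forest_plus f = g"
proof -
  interpret G: forest g using g by (rule RF_imp_forest)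
  have vg: "verts g = {1..n + 1}" using g by (rule RF_verts)
  then have "verts g \<noteq> {}" by simp
  note fp = G.first_path[OF this, unfolded first_leaf_def path]
  let ?f = "detach g (n + 1)" and ?p = "last q"
  have p: "parent g ?p (n + 1)" using fp(3) path(2) by (simp add: successively_append_iff)
  have leaf: "leaf g (n + 1)" using fp(4) by simp
  have "{1..n + 1} - {n + 1} = {1..n}" by auto
  then have vf: "verts ?f = {1..n}" using vg by (metis detach_def rforest.select_convs(1))
  note h = G.is_height_detach[OF leaf G.parent_not_root[OF p]]
  have f: "?f \<in> RF n" using is_height_imp_RF[OF h vf] .
  interpret F: forest ?f using f by (rule RF_imp_forest)
  have par: "parent g u v" if "parent ?f u v" for u v
  proof -
    have "ht ?f u = ht g u" "ht ?f v = ht g v" using F.parent_verts[OF that] ht_eq[OF h vf] by blast+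
    moreover have "adj g u v" using that by (simp add: parent_def adj_def detach_def)
    ultimately show ?thesis using that by (simp add: parent_def)
  qed
  \<comment> \<open>A child of \<open>?p\<close> surviving the deletion would be a sibling of
    \<open>n + 1\<close>, against \<open>alone\<close>.\<close>
  have "leaf ?f ?p"
  proof -
    have "?p \<noteq> n + 1" using p by (auto simp: parent_def)
    then have "?p \<in> verts ?f" using G.parent_verts[OF p] by (simp add: detach_def)
    moreover have False if "parent ?f ?p w" for w
    proof -
      have "w \<in> sibs g (n + 1)" using par[OF that] G.sibs_child[OF p] by simp
      then show False using alone F.parent_verts[OF that] vf by simp
    qed
    ultimately show ?thesis by (auto simp: leaf_def)
  qed
  note att = attached_of_RF[OF f this]
  have eq: "attach ?f ?p (n + 1) = g" using G.attach_detach[OF leaf p] .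
  interpret attached ?f ?p "n + 1" by (rule att)
  have "path g (hd (q @ [n + 1])) (q @ [n + 1]) (n + 1)"
    using G.descending_path[OF fp(3) fp(1) G.roots_verts[OF fp(2)]] by simp
  then have q: "v \<in> verts ?f" if "v \<in> set q" for v
  proof -
    have "v \<in> verts g" "v \<noteq> n + 1" using \<open>path g _ _ _\<close> that by (auto simp: path_def walk_def)
    then show ?thesis by (simp add: detach_def)
  qed
  have "successively (parent g) q" using fp(3) by (simp add: successively_append_iff)
  moreover have "parent ?f u v" if "parent g u v" "v \<in> set q" for u v
    using that q[of v] vf parent_attach[unfolded eq] by auto
  ultimately have succ: "successively (parent ?f) q"
    by (metis (no_types, lifting) successively_cong par)
  have "eta ?f v = 1" if "v \<in> set q" for v
  proof -
    have "eta g v = 1" using fp(5) that by auto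
    then show ?thesis using eta_attach[OF q[OF that], unfolded eq] by metis
  qed
  moreover have "hd q \<in> roots ?f" using fp(2) path(2) by (simp add: detach_def)
  ultimately have "first_path ?f = q"
    using F.first_path_eqI path(2) succ \<open>leaf ?f ?p\<close> by blast
  then have "forest_plus ?f = attach ?f ?p (n + 1)"
    using vf by (simp add: forest_plus_attach first_leaf_def)
  then show ?thesis using f eq by auto
qed

text \<open>A permutation contains \<open>n + 1\<close>, and for \<open>k > 1\<close> it is a
  required entry because \<open>k \<le> n\<close>. Its index is then located by
  \<open>last_column_snoc\<close>.\<close>

lemma RF_k_first_leaf:
  assumes g: "g \<in> RF_k (n + 1) k" and "1 \<le> k" "k \<le> n"
  shows "sibs g (first_leaf g) = {first_leaf g}"
    "\<exists>q. q \<noteq> [] \<and> first_path g = q @ [first_leaf g]"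
proof -
  have R: "g \<in> RF (n + 1)" using g by (auto simp: RF_k_def split: if_splits)
  interpret G: forest g using R by (rule RF_imp_forest)
  have vg: "verts g = {1..n + 1}" using R by (rule RF_verts)
  then have ne: "verts g \<noteq> {}" by simp
  let ?t = "binary_tree g"
  have S: "set_tree ?t = {1..n + 1}" "size ?t = n + 1"
    using G.set_binary_tree G.size_binary_tree vg by auto
  have "n + 1 \<in> set (phi g)"
  proof (cases "k = 1")
    case True
    then have "mset (phi g) = mset [1..<n + 1 + 1]" using g unfolding RF_k_def by simp
    then have "set (phi g) = set [1..<n + 1 + 1]" by (rule mset_eq_setD)
    then show ?thesis by simp
  next
    case False
    then have "{k + 1..n + 1} \<subseteq> set (phi g)" using g by (simp add: RF_k_def PF_missing_def)
    then show ?thesis using assms by auto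
  qed
  moreover have "set (phi g) = (\<lambda>i. Suc (column i (dyck_word ?t))) ` {1..n + 1}"
    using vg by (simp add: phi_column atLeastLessThanSuc_atLeastAtMost del: upt_Suc)
  ultimately have "n + 1 \<in> (\<lambda>i. Suc (column i (dyck_word ?t))) ` {1..n + 1}" by (simp only:)
  then obtain i where "n + 1 = Suc (column i (dyck_word ?t))" "i \<in> {1..n + 1}" by (rule imageE)
  then obtain s where s: "?t = snoc s i" using last_column_snoc[of i ?t] S by metis
  have fp: "first_path g = spine s @ [i]" using G.first_path_eq[OF ne] s by (simp add: spine_snoc)
  then have i: "first_leaf g = i" by (simp add: first_leaf_def)
  have "next_sibling g i = None"
    using G.binary_subtree_snoc_next_sibling[OF G.binary_subtree_first_root s] .
  moreover have "eta g i = 1" "i \<in> verts g" using G.first_path[OF ne] fp i by (auto simp: leaf_def)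
  ultimately show "sibs g (first_leaf g) = {first_leaf g}" using G.next_sibling_None_imp i by simp
  \<comment> \<open>The tree has \<open>n + 1 \<ge> 2\<close> vertices, so the spine does not
    consist of \<open>i\<close> alone, and \<open>i\<close> has a parent.\<close>
  have "s \<noteq> \<langle>\<rangle>" using s S(2) assms by auto
  then show "\<exists>q. q \<noteq> [] \<and> first_path g = q @ [first_leaf g]" using fp i spine_eq_Nil_iff by blast
qed

lemma RF_k_equiv_forest_plus:
  assumes g: "g \<in> RF_k (n + 1) k" and "1 \<le> k" "k \<le> n"
  shows "\<exists>f \<in> RF n. (g, forest_plus f) \<in> RF_rel (n + 1)"
proof -
  have R: "g \<in> RF (n + 1)" using g by (auto simp: RF_k_def split: if_splits)
  interpret G: forest g using R by (rule RF_imp_forest)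
  have vg: "verts g = {1..n + 1}" using R by (rule RF_verts)
  then have ne: "verts g \<noteq> {}" by simp
  define x where "x = first_leaf g"
  have x: "x \<in> {1..n + 1}" using G.first_path(4)[OF ne] vg by (simp add: leaf_def x_def)
  have xv: "x \<in> verts g" using x vg by simp
  obtain q where q: "q \<noteq> []" "first_path g = q @ [x]" and alone: "sibs g x = {x}"
    using RF_k_first_leaf[OF assms] by (auto simp: x_def)
  \<comment> \<open>Moves \<open>x\<close> to \<open>n + 1\<close> and shifts the larger labels down
    to close the gap; order is kept among all other labels.\<close>
  define \<sigma> where "\<sigma> y = (if y = x then n + 1 else if x < y then y - 1 else y)" for y
  have "inj_on \<sigma> {1..n + 1}" by (rule inj_onI) (use x in \<open>auto simp: \<sigma>_def split: if_splits\<close>)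
  moreover have "\<sigma> ` {1..n + 1} \<subseteq> {1..n + 1}" using x by (auto simp: \<sigma>_def)
  ultimately have bij: "bij_betw \<sigma> {1..n + 1} {1..n + 1}"
    by (simp add: bij_betw_def endo_inj_surj)
  \<comment> \<open>Only \<open>x\<close> is moved out of order, and its sibling set is a
    singleton.\<close>
  have mono: "strict_mono_on (sibs g v) \<sigma>" if v: "v \<in> verts g" for v
  proof (cases "x \<in> sibs g v")
    case True
    then have "sibs g v = {x}" using G.sibs_eq[OF v True] alone by simp
    then show ?thesis by (simp add: strict_mono_on_def)
  next
    case False
    then show ?thesis by (intro strict_mono_onI) (auto simp: \<sigma>_def)
  qed
  note iso = relabel_iso[OF R bij mono]
  interpret forest_iso g "relabel \<sigma> g" \<sigma> by (rule iso(2))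
  have "\<sigma> x = n + 1" by (simp add: \<sigma>_def)
  have "verts (relabel \<sigma> g) \<noteq> {}" using ne image_verts by blast
  then have "first_path (relabel \<sigma> g) = map \<sigma> (first_path g)"
    using G.first_path_eq[OF ne] g.first_path_eq binary_tree_iso spine_map_tree by metis
  then have "first_path (relabel \<sigma> g) = map \<sigma> q @ [n + 1]" using q \<open>\<sigma> x = n + 1\<close> by simp
  moreover have "sibs (relabel \<sigma> g) (n + 1) = {n + 1}"
  proof -
    have "v = n + 1" if v: "v \<in> sibs (relabel \<sigma> g) (\<sigma> x)" for v
    proof -
      have "v \<in> verts (relabel \<sigma> g)" using v g.sibs_verts[OF in_verts[OF xv]] by blast
      then obtain u where u: "u \<in> verts g" "v = \<sigma> u" using image_verts by blast
      then have "u \<in> sibs g x" using v sibs_iso xv by simp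
      then show ?thesis using alone u \<open>\<sigma> x = n + 1\<close> by simp
    qed
    then show ?thesis using \<open>\<sigma> x = n + 1\<close> g.self_in_sibs by auto
  qed
  ultimately obtain f where "f \<in> RF n" "forest_plus f = relabel \<sigma> g"
    using forest_plus_surj[OF iso(1)] q(1) by blast
  moreover have "(g, relabel \<sigma> g) \<in> RF_rel (n + 1)" using R iso RF_rel_iso by blast
  ultimately show ?thesis by metis
qed

theorem proposition4p12:
  fixes n k :: nat
  assumes "1 \<le> k" and "k \<le> n"
  shows "{C \<in> RF (n + 1) // RF_rel (n + 1). C \<subseteq> RF_k (n + 1) k}
         = {RF_rel (n + 1) `` {forest_plus f} | f. f \<in> RF_k n k}"
proof (intro equalityI subsetI)
  fix C assume "C \<in> {C \<in> RF (n + 1) // RF_rel (n + 1). C \<subseteq> RF_k (n + 1) k}"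
  then obtain g where g: "g \<in> RF (n + 1)" "C = RF_rel (n + 1) `` {g}" "C \<subseteq> RF_k (n + 1) k"
    by (auto elim: quotientE)
  then have "g \<in> RF_k (n + 1) k" using equiv_class_self[OF equiv_RF_rel] by blast
  then obtain f where f: "f \<in> RF n" "(g, forest_plus f) \<in> RF_rel (n + 1)"
    using RF_k_equiv_forest_plus assms by blast
  \<comment> \<open>\<open>forest_plus f\<close> lies in the class \<open>C\<close>, hence in
    \<open>RF_k (n + 1) k\<close>; only from this does membership of \<open>f\<close>
    follow.\<close>
  then have "forest_plus f \<in> RF_k (n + 1) k" using g by blast
  then have "f \<in> RF_k n k" using forest_plus_RF_k[OF f(1)] assms by blast
  moreover have "C = RF_rel (n + 1) `` {forest_plus f}"
    using g(2) equiv_class_eq[OF equiv_RF_rel f(2)] by simp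
  ultimately show "C \<in> {RF_rel (n + 1) `` {forest_plus f} | f. f \<in> RF_k n k}" by blast
next
  fix C assume "C \<in> {RF_rel (n + 1) `` {forest_plus f} | f. f \<in> RF_k n k}"
  then obtain f where f: "f \<in> RF_k n k" "C = RF_rel (n + 1) `` {forest_plus f}" by blast
  then have "f \<in> RF n" by (auto simp: RF_k_def split: if_splits)
  then have "forest_plus f \<in> RF (n + 1)" "forest_plus f \<in> RF_k (n + 1) k"
    using forest_plus_RF(1) forest_plus_RF_k f(1) assms by auto
  then show "C \<in> {C \<in> RF (n + 1) // RF_rel (n + 1). C \<subseteq> RF_k (n + 1) k}"
    using f(2) RF_k_RF_rel by (auto intro: quotientI)
qed

end
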